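(* Let $\lambda>0$ and let $c_k\in(0,1)$, $k\ge1$, be centers such that assumptions (A1), (A2), (A3) below hold for the lengths $e^{-\lambda k}$. For $\alpha>0$ let $l_k=e^{-\lambda k^\alpha}$, let $I_k$ be the open interval of length $l_k$ centered at $c_k$, and let $S=\bigcap_{m\ge1}\bigcup_{k\ge m}I_k$. Then (1) if $0<\alpha\le1$, $\mathrm{Cap}(S)=\mathrm{Cap}([0,1])>0$; (2) if $\alpha>1$, $\mathrm{Cap}(S)=0$.
   Context: Interaction: $I(\nu,\mu)=\iint(-\log|z-w|)\,d\nu(z)\,d\mu(w)$, energy $I(\mu)=I(\mu,\mu)$; capacity $\mathrm{Cap}(E)=\exp(-\inf I(\mu))$, infimum over Borel probability measures with compact support contained in $E$ ($e^{-\infty}=0$). Notation: $\mathcal{A}_n=\{n,\dots,2n-1\}$, $\mathcal{A}_{n,q}=\mathcal{A}_n\cup\mathcal{A}_{2n}\cup\cdots\cup\mathcal{A}_{2^qn}$. The assumptions, with $L_k=e^{-\lambda k}$: (A1) There is $\phi\in L^1([0,1],dx)$, $\phi>0$ a.e., with $\frac{1}{\#\mathcal{A}_n}\sum_{k\in\mathcal{A}_n}f(c_k)\to\int_0^1 f\phi\,dx$ for every $f\in C([0,1])$. There are integers $q(n)\to\infty$ such that: (A2) for every $\varepsilon>0$ there is $\delta>0$ such that for all large $n$ and all $n',n''\in\{n,2n,\dots,2^{q(n)}n\}$, $\frac{1}{\#(\mathcal{A}_{n'}\times\mathcal{A}_{n''})}\sum_{i\in\mathcal{A}_{n'},j\in\mathcal{A}_{n''},\,i\neq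 j,\,|c_i-c_j|<\delta}(-\log|c_i-c_j|)<\varepsilon$; (A3) for every $\varepsilon>0$, for all large $n$ and all $i\ne j$ in $\mathcal{A}_{n,q(n)}$, $\frac{L_i+L_j}{2|c_i-c_j|}<\varepsilon$. *)

theory Defs
  imports "HOL-Probability.Probability"
begin

definition log_kernel_pos :: "complex \<times> complex \<Rightarrow> ennreal" where
  "log_kernel_pos p = (if fst p = snd p then \<infinity>
     else ennreal (max 0 (- ln (cmod (fst p - snd p)))))"

definition log_kernel_neg :: "complex \<times> complex \<Rightarrow> ennreal" where
  "log_kernel_neg p = (if fst p = snd p then 0
     else ennreal (max 0 (ln (cmod (fst p - snd p)))))"

definition log_energy :: "complex measure \<Rightarrow> ereal" where
  "log_energy M =
     enn2ereal (\<integral>\<^sup>+ p. log_kernel_pos p \<partial>(M \<Otimes>\<^sub>M M))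
     - enn2ereal (\<integral>\<^sup>+ p. log_kernel_neg p \<partial>(M \<Otimes>\<^sub>M M))"

definition compact_prob_measures :: "complex set \<Rightarrow> complex measure set" where
  "compact_prob_measures E =
     {M. sets M = sets borel \<and> prob_space M \<and>
         (\<exists>K. compact K \<and> K \<subseteq> E \<and> emeasure M K = 1)}"

definition log_capacity :: "complex set \<Rightarrow> ereal" where
  "log_capacity E =
     (let J = (INF M\<in>compact_prob_measures E. log_energy M) in
       if J = \<infinity> then 0 else if J = - \<infinity> then \<infinity>
       else ereal (exp (- real_of_ereal J)))"

definition blockA :: "nat \<Rightarrow> nat set" where
  "blockA n = {n..<2*n}"

definition blockAq :: "nat \<Rightarrow> nat \<Rightarrow> nat set" where
  "blockAq n q = (\<Union>a\<le>q. blockA (2^a * n))"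

definition limsup_intervals :: "(nat \<Rightarrow> real) \<Rightarrow> (nat \<Rightarrow> real) \<Rightarrow> real set" where
  "limsup_intervals c l =
     (\<Inter>m\<in>{1..}. \<Union>k\<in>{m..}. {c k - l k / 2 <..< c k + l k / 2})"

end

theory Submission
  imports Defs
begin

text \<open>
  For \<open>\<alpha> > 1\<close>, restrict a measure of finite energy to a set where its potential is at most \<open>N\<close>.
  There every \<open>I\<^sub>k\<close> has mass at most \<open>N / (\<lambda> k powr \<alpha>)\<close>, so Borel--Cantelli gives \<open>S\<close> measure zero.

  For \<open>\<alpha> \<le> 1\<close>, it suffices to treat \<open>\<alpha> = 1\<close> and to show that a measure \<open>\<mu>\<close> on \<open>[0,1]\<close> with energy
  below \<open>b\<close> can be replaced by one on a compact subset of \<open>S\<close> with energy at most \<open>b\<close>. Smoothing makes \<open>\<mu>\<close>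
  absolutely continuous at an arbitrarily small cost. Since the limit distribution \<open>\<phi> dx\<close> of the centers
  has positive density and (by A2) finite energy, \<open>\<mu>\<close> is approximated by \<open>f \<phi> dx\<close> with \<open>f\<close> continuous,
  and this in turn by weights \<open>f (c\<^sub>k)\<close> spread uniformly over intervals shorter than \<open>I\<^sub>k\<close>. The off-diagonal
  energy converges by A1--A3. The self-energy of one block is of order \<open>\<lambda>\<close> and does not tend to zero;
  averaging over the \<open>q(n) + 1\<close> blocks divides it by \<open>q(n) + 1\<close>.
  Iterating inside the intervals already chosen gives nested compact sets, and a weak limit of
  the measures lives on their intersection, with energy at most \<open>b\<close> by lower semicontinuity.
\<close>

section \<open>Logarithmic energy on the real line\<close>

text \<open>A block of N intervals with weights about 1/N has N self-energies of size about
  \<open>lam\<close> * N, each entering with weight 1/N^2, so its diagonal part is of order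
  \<open>lam\<close> for every N. Blocks at different dyadic levels are disjoint: if q+1 of them get
  weight 1/(q+1) each, only q+1 of the (q+1)^2 pairs of blocks have a diagonal part. All other
  contributions are off-diagonal and approach the same continuous energy. Hence the estimates have
  to be uniform over all pairs of blocks up to level \<open>q n\<close>.

  The bound "energy < b" is strict. Each approximation is made inside the gap that is left, so the
  same \<open>b\<close> serves every refinement and no errors are summed along the iteration;
  equality becomes possible only in the weak limit. Normalization is postponed: a weight
  \<open>f\<close> is compared with \<open>b\<close> times the square of its mass.

  A refined measure is again absolutely continuous and carried by an open set, which lets the
  refinement be repeated inside it.

  All sets lie in [0,1], where - log |x - y| is nonnegative, so the truncation at 0 in
  \<open>lk\<close> changes nothing there, and Tonelli and Fatou apply to every energy.\<close>

definition lk :: "real \<Rightarrow> real \<Rightarrow> ennreal" where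
  "lk x y = (if x = y then \<infinity> else ennreal (max 0 (- ln \<bar>x - y\<bar>)))"

definition energy :: "real measure \<Rightarrow> ennreal" where
  "energy \<mu> = (\<integral>\<^sup>+x. \<integral>\<^sup>+y. lk x y \<partial>\<mu> \<partial>\<mu>)"

lemma log_kernel_pos_of_real: "log_kernel_pos (of_real x, of_real y) = lk x y"
  unfolding log_kernel_pos_def lk_def by (simp flip: of_real_diff)

lemma measurable_lk [measurable (raw)]:
  assumes [measurable]: "f \<in> borel_measurable M" "g \<in> borel_measurable M"
  shows "(\<lambda>x. lk (f x) (g x)) \<in> borel_measurable M"
  unfolding lk_def by measurable

lemma lk_le:
  assumes "0 < d" "d \<le> \<bar>x - y\<bar>"
  shows "lk x y \<le> ennreal (max 0 (- ln d))"
proof -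
  have "ln d \<le> ln \<bar>x - y\<bar>" using assms by simp
  then show ?thesis using assms unfolding lk_def by (auto intro!: ennreal_leI)
qed

lemma lk_ge:
  assumes "\<bar>x - y\<bar> \<le> d" "0 < d"
  shows "ennreal (- ln d) \<le> lk x y"
proof (cases "x = y")
  case False
  then have "ln \<bar>x - y\<bar> \<le> ln d" using assms by simp
  then show ?thesis using False unfolding lk_def by (auto intro!: ennreal_leI)
qed (simp add: lk_def)

section \<open>The logarithmic potential of a uniform distribution\<close>

lemma tendsto_mult_ln_at_right_0: "((\<lambda>u::real. u * ln u) \<longlongrightarrow> 0) (at_right 0)"
proof -
  have "((\<lambda>u::real. - (ln (inverse u) / inverse u)) \<longlongrightarrow> - 0) (at_right 0)"
    by (intro tendsto_minus filterlim_compose[OF ln_x_over_x_tendsto_0 filterlim_inverse_at_top_right])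
  moreover have "\<forall>\<^sub>F u::real in at_right 0. - (ln (inverse u) / inverse u) = u * ln u"
    by (auto simp: ln_inverse divide_inverse mult.commute intro!: eventually_at_rightI[of 0 1])
  ultimately show ?thesis
    by (simp cong: tendsto_cong filterlim_cong)
qed

lemma nn_integral_ln_quotient:
  fixes l :: real
  assumes l: "0 < l"
  shows "(\<integral>\<^sup>+u. ennreal (indicator {0<..l} u * (ln l - ln u)) \<partial>lborel) = ennreal l"
proof (rule nn_integral_has_integral_lborel)
  \<comment> \<open>An antiderivative of \<open>ln l - ln u\<close>. By the preceding limit it is
    continuous at 0 with value 0, and its value at \<open>l\<close> is \<open>l\<close>.\<close>
  let ?F = "\<lambda>u::real. u + u * ln l - u * ln u"
  have "continuous_on {0..l} ?F"
  proof (rule continuous_on_IccI)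
    have "(?F \<longlongrightarrow> 0 + 0 * ln l - 0) (at_right 0)"
      by (intro tendsto_intros tendsto_mult_ln_at_right_0)
    then show "(?F \<longlongrightarrow> ?F 0) (at_right 0)" by simp
    show "(?F \<longlongrightarrow> ?F l) (at_left l)"
      using l by (intro tendsto_intros) auto
    show "?F \<midarrow>x\<rightarrow> ?F x" if "0 < x" for x
      using that by (auto intro!: tendsto_intros)
  qed (use l in auto)
  then have "((\<lambda>u. ln l - ln u) has_integral (?F l - ?F 0)) {0..l}"
    using l
    by (intro fundamental_theorem_of_calculus_interior)
       (auto intro!: derivative_eq_intros simp flip: has_real_derivative_iff_has_vector_derivative)
  then have "((\<lambda>u. ln l - ln u) has_integral l) {0<..l}"
    by (subst has_integral_spike_set_eq[where T="{0..l}"])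
       (auto intro: negligible_subset[of "{0}"] simp: not_less)
  then show "((\<lambda>u. indicator {0<..l} u * (ln l - ln u)) has_integral l) UNIV"
    unfolding has_integral_restrict_UNIV[of "{0<..l}", symmetric] by (rule has_integral_eq[rotated]) auto
qed (auto simp: indicator_def)

lemma ennreal_plus3:
  "0 \<le> a \<Longrightarrow> 0 \<le> b \<Longrightarrow> 0 \<le> c \<Longrightarrow> ennreal (a + (b + c)) = ennreal a + (ennreal b + ennreal c)"
  by simp

text \<open>Only points within distance \<open>l\<close> of \<open>x\<close> push the kernel above
  \<open>- ln l\<close>. The excess integrates to at most \<open>l\<close> on each side of
  \<open>x\<close>; after division by \<open>l\<close> the two sides give the 2. The bound depends
  neither on \<open>x\<close> nor on the position of the interval.\<close>

lemma nn_integral_lk_uniform_le: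
  fixes l a x :: real
  assumes l: "0 < l" "l \<le> 1"
  shows "(\<integral>\<^sup>+y. ennreal (1 / l) * indicator {a..a + l} y * lk x y \<partial>lborel) \<le> ennreal (2 - ln l)"
proof -
  define G where "G u = ennreal (indicator {0<..l} u * (ln l - ln u))" for u :: real
  have [measurable]: "G \<in> borel_measurable borel" unfolding G_def by measurable
  have G: "(\<integral>\<^sup>+u. G u \<partial>lborel) = ennreal l"
    unfolding G_def by (rule nn_integral_ln_quotient) fact
  have le: "lk x y \<le> ennreal (- ln l) + (G (y - x) + G (x - y))" if "y \<noteq> x" for y
  proof -
    have "lk x y = ennreal (max 0 (- ln \<bar>x - y\<bar>))" using that by (simp add: lk_def)
    also have "\<dots> \<le> ennreal (- ln l + (indicator {0<..l} (y - x) * (ln l - ln (y - x)) + indicator {0<..l} (x - y) * (ln l - ln (x - y))))"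
    proof (rule ennreal_leI)
      have "ln l \<le> ln \<bar>x - y\<bar>" if "l < \<bar>x - y\<bar>" using l that by simp
      then show "max 0 (- ln \<bar>x - y\<bar>) \<le> - ln l + (indicator {0<..l} (y - x) * (ln l - ln (y - x)) + indicator {0<..l} (x - y) * (ln l - ln (x - y)))"
        using l that by (auto simp: indicator_def abs_if)
    qed
    also have "\<dots> = ennreal (- ln l) + (G (y - x) + G (x - y))"
    proof -
      have "0 \<le> indicator {0<..l} u * (ln l - ln u)" for u :: real
        by (auto simp: indicator_def)
      then show ?thesis unfolding G_def using l by (intro ennreal_plus3) auto
    qed
    finally show ?thesis .
  qed
  have int: "(\<integral>\<^sup>+y. G (y - x) \<partial>lborel) = ennreal l" "(\<integral>\<^sup>+y. G (x - y) \<partial>lborel) = ennreal l"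
    using nn_integral_real_affine[of "G" 1 "-x"] nn_integral_real_affine[of "G" "-1" "x"]
    by (simp_all add: G)
  have "(\<integral>\<^sup>+y. ennreal (1 / l) * indicator {a..a + l} y * lk x y \<partial>lborel)
      \<le> (\<integral>\<^sup>+y. ennreal (1 / l) * (ennreal (- ln l) * indicator {a..a + l} y + (G (y - x) + G (x - y))) \<partial>lborel)"
  proof (rule nn_integral_mono_AE, use AE_lborel_singleton[of x] in eventually_elim)
    case (elim y)
    have "indicator {a..a+l} y * lk x y \<le> indicator {a..a+l} y * (ennreal (- ln l) + (G (y - x) + G (x - y)))"
      by (intro mult_left_mono le elim) simp
    also have "\<dots> \<le> ennreal (- ln l) * indicator {a..a + l} y + (G (y - x) + G (x - y))"
      by (auto simp: indicator_def)
    finally show ?case by (simp add: mult.assoc mult_left_mono)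
  qed
  also have "\<dots> = ennreal (1 / l) * (ennreal (- ln l) * ennreal l + (ennreal l + ennreal l))"
    using l by (simp add: nn_integral_cmult nn_integral_add int nn_integral_cmult_indicator)
  also have "\<dots> = ennreal (2 - ln l)"
  proof -
    let ?p = "- ln l * l"
    have p: "0 \<le> ?p" using l by (intro mult_nonneg_nonneg) auto
    have "ennreal (- ln l) * ennreal l = ennreal ?p"
      by (rule ennreal_mult[symmetric]) (use l in auto)
    moreover have "ennreal ?p + (ennreal l + ennreal l) = ennreal (?p + (l + l))"
      using l p by (intro ennreal_plus3[symmetric]) auto
    moreover have "ennreal (1 / l) * ennreal (?p + (l + l)) = ennreal (1 / l * (?p + (l + l)))"
      using l p by (intro ennreal_mult[symmetric] add_nonneg_nonneg) auto
    moreover have "1 / l * (?p + (l + l)) = 2 - ln l" using l by (simp add: field_simps)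
    ultimately show ?thesis by simp
  qed
  finally show ?thesis .
qed

text \<open>Here \<open>v x\<close> is the density into which the point \<open>x\<close> is smeared;
  Tonelli turns the energy of the mixture into an average of mutual energies. It serves twice: with
  \<open>M\<close> a measure on the line when smoothing, and with \<open>M\<close> a finite weighted
  set of indices when discretizing.\<close>

lemma energy_density_mixture:
  assumes "sigma_finite_measure M"
    and v[measurable]: "case_prod v \<in> borel_measurable (M \<Otimes>\<^sub>M lborel)"
  shows "energy (density lborel (\<lambda>y. \<integral>\<^sup>+x. v x y \<partial>M))
    = (\<integral>\<^sup>+x. \<integral>\<^sup>+x'. (\<integral>\<^sup>+y. v x y * (\<integral>\<^sup>+y'. v x' y' * lk y y' \<partial>lborel) \<partial>lborel) \<partial>M \<partial>M)"
proof -
  interpret sigma_finite_measure M by fact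
  interpret Q: pair_sigma_finite M lborel ..
  interpret QM: pair_sigma_finite M M ..
  let ?A = "\<lambda>x' y. \<integral>\<^sup>+y'. v x' y' * lk y y' \<partial>lborel"
  have [measurable]: "(\<lambda>y. \<integral>\<^sup>+x. v x y \<partial>M) \<in> borel_measurable borel"
    by measurable
  have inner: "(\<integral>\<^sup>+y'. (\<integral>\<^sup>+x'. v x' y' \<partial>M) * lk y y' \<partial>lborel) = (\<integral>\<^sup>+x'. ?A x' y \<partial>M)" for y
  proof -
    have "(\<integral>\<^sup>+y'. (\<integral>\<^sup>+x'. v x' y' \<partial>M) * lk y y' \<partial>lborel) = (\<integral>\<^sup>+y'. (\<integral>\<^sup>+x'. v x' y' * lk y y' \<partial>M) \<partial>lborel)"
      by (simp add: nn_integral_multc)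
    also have "\<dots> = (\<integral>\<^sup>+x'. ?A x' y \<partial>M)"
      by (rule Q.Fubini') measurable
    finally show ?thesis .
  qed
  have "energy (density lborel (\<lambda>y. \<integral>\<^sup>+x. v x y \<partial>M))
      = (\<integral>\<^sup>+y. (\<integral>\<^sup>+x. v x y \<partial>M) * (\<integral>\<^sup>+x'. ?A x' y \<partial>M) \<partial>lborel)"
    unfolding energy_def inner[symmetric] by (simp add: nn_integral_density)
  also have "\<dots> = (\<integral>\<^sup>+y. (\<integral>\<^sup>+x. \<integral>\<^sup>+x'. v x y * ?A x' y \<partial>M \<partial>M) \<partial>lborel)"
    by (simp add: nn_integral_multc nn_integral_cmult)
  also have "\<dots> = (\<integral>\<^sup>+x. (\<integral>\<^sup>+y. \<integral>\<^sup>+x'. v x y * ?A x' y \<partial>M \<partial>lborel) \<partial>M)"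
    by (rule Q.Fubini') measurable
  also have "\<dots> = (\<integral>\<^sup>+x. (\<integral>\<^sup>+x'. \<integral>\<^sup>+y. v x y * ?A x' y \<partial>lborel \<partial>M) \<partial>M)"
    by (intro nn_integral_cong Q.Fubini') measurable
  finally show ?thesis .
qed

lemma prob_space_density_mixture:
  assumes "prob_space M"
    and v[measurable]: "case_prod v \<in> borel_measurable (M \<Otimes>\<^sub>M lborel)"
    and v1: "AE x in M. (\<integral>\<^sup>+y. v x y \<partial>lborel) = 1"
  shows "prob_space (density lborel (\<lambda>y. \<integral>\<^sup>+x. v x y \<partial>M))"
proof
  interpret prob_space M by fact
  interpret Q: pair_sigma_finite M lborel ..
  have "(\<integral>\<^sup>+y. \<integral>\<^sup>+x. v x y \<partial>M \<partial>lborel) = (\<integral>\<^sup>+x. \<integral>\<^sup>+y. v x y \<partial>lborel \<partial>M)"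
    by (rule Q.Fubini') measurable
  also have "\<dots> = (\<integral>\<^sup>+x. 1 \<partial>M)"
    by (rule nn_integral_cong_AE) fact
  finally show "emeasure (density lborel (\<lambda>y. \<integral>\<^sup>+x. v x y \<partial>M)) (space (density lborel (\<lambda>y. \<integral>\<^sup>+x. v x y \<partial>M))) = 1"
    by (simp add: emeasure_density emeasure_space_1)
qed

lemma AE_density_mixture:
  assumes "sigma_finite_measure M"
    and v[measurable]: "case_prod v \<in> borel_measurable (M \<Otimes>\<^sub>M lborel)"
    and U: "AE x in M. \<forall>y. y \<notin> U \<longrightarrow> v x y = 0"
  shows "AE y in density lborel (\<lambda>y. \<integral>\<^sup>+x. v x y \<partial>M). y \<in> U"
proof -
  interpret sigma_finite_measure M by fact
  have "(\<integral>\<^sup>+x. v x y \<partial>M) = 0" if "y \<notin> U" for y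
    using U that by (intro nn_integral_0_iff_AE[THEN iffD2]) (auto elim: eventually_mono)
  moreover have "(\<lambda>y. \<integral>\<^sup>+x. v x y \<partial>M) \<in> borel_measurable lborel" by measurable
  ultimately show ?thesis by (subst AE_density) (force intro!: AE_I2)+
qed

section \<open>Mutual energies of uniform distributions on intervals\<close>

lemma nn_integral_uniform_const:
  "0 < l \<Longrightarrow> (\<integral>\<^sup>+y. ennreal (1/l) * indicator {a..a+l} y * C \<partial>lborel) = C"
proof -
  assume l: "0 < l"
  then have "ennreal (1 / l) * ennreal l = 1" by (simp flip: ennreal_mult)
  then show ?thesis
    using l by (simp add: nn_integral_multc nn_integral_cmult_indicator)
qed

lemma mutual_uniform_energy_le:
  assumes l: "0 < l" "0 < l'" "0 \<le> C"
    and C: "\<And>y y'. y \<in> {a..a+l} \<Longrightarrow> y' \<in> {a'..a'+l'} \<Longrightarrow> lk y y' \<le> ennreal C"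
  shows "(\<integral>\<^sup>+y. ennreal (1/l) * indicator {a..a+l} y *
           (\<integral>\<^sup>+y'. ennreal (1/l') * indicator {a'..a'+l'} y' * lk y y' \<partial>lborel) \<partial>lborel) \<le> ennreal C"
proof -
  have *: "(\<integral>\<^sup>+y. ennreal (1/l) * indicator {a..a+l} y * f y \<partial>lborel) \<le> ennreal C"
    if "0 < l" "\<And>y. y \<in> {a..a+l} \<Longrightarrow> f y \<le> ennreal C" for a l :: real and f
  proof -
    have "(\<integral>\<^sup>+y. ennreal (1/l) * indicator {a..a+l} y * f y \<partial>lborel)
        \<le> (\<integral>\<^sup>+y. ennreal (1/l) * indicator {a..a+l} y * ennreal C \<partial>lborel)"
      using that(2) by (intro nn_integral_mono) (auto simp: indicator_def intro!: mult_left_mono)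
    also have "\<dots> = ennreal C" by (rule nn_integral_uniform_const) fact
    finally show ?thesis .
  qed
  show ?thesis
    by (intro * C) (use l in auto)
qed

text \<open>No separation of the two intervals is assumed, so this covers overlapping ones, in
  particular the self-energy of a uniform distribution.\<close>

lemma mutual_uniform_energy_le_ln:
  assumes l: "0 < l" "0 < l'" "l' \<le> 1"
  shows "(\<integral>\<^sup>+y. ennreal (1/l) * indicator {a..a+l} y *
           (\<integral>\<^sup>+y'. ennreal (1/l') * indicator {a'..a'+l'} y' * lk y y' \<partial>lborel) \<partial>lborel) \<le> ennreal (2 - ln l')"
proof -
  have "(\<integral>\<^sup>+y. ennreal (1/l) * indicator {a..a+l} y *
           (\<integral>\<^sup>+y'. ennreal (1/l') * indicator {a'..a'+l'} y' * lk y y' \<partial>lborel) \<partial>lborel)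
      \<le> (\<integral>\<^sup>+y. ennreal (1/l) * indicator {a..a+l} y * ennreal (2 - ln l') \<partial>lborel)"
    by (intro nn_integral_mono mult_left_mono nn_integral_lk_uniform_le l) auto
  also have "\<dots> = ennreal (2 - ln l')"
    by (rule nn_integral_uniform_const) fact
  finally show ?thesis .
qed

text \<open>Every point is spread over an interval of length \<open>t\<close>. Pairs farther apart
  than \<open>D * t\<close> keep their kernel up to an additive \<open>\<eta>\<close>. For closer
  pairs the old kernel is already at least \<open>K\<close>, while the new value is at most
  \<open>2 - ln t\<close>, hence at most \<open>K * (1 + \<eta>)\<close>. So an energy
  \<open>E\<close> grows to at most \<open>E * (1 + \<eta>) + \<eta>\<close>.\<close>

lemma energy_smoothing:
  fixes \<mu> :: "real measure"
  assumes "prob_space \<mu>" and sets[measurable_cong]: "sets \<mu> = sets borel"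
    and AE01: "AE x in \<mu>. x \<in> {0..1}" and B: "energy \<mu> < B"
  shows "\<exists>\<mu>'. prob_space \<mu>' \<and> sets \<mu>' = sets borel \<and> absolutely_continuous lborel \<mu>' \<and>
           (AE x in \<mu>'. x \<in> {0<..<1}) \<and> energy \<mu>' < B"
proof -
  interpret prob_space \<mu> by fact
  obtain E where E: "energy \<mu> = ennreal E" "0 \<le> E"
    using B by (cases "energy \<mu>") auto
  obtain \<eta> where \<eta>: "\<eta> > 0" "ennreal (E * (1 + \<eta>) + \<eta>) < B"
  proof -
    have "((\<lambda>\<eta>. ennreal (E * (1 + \<eta>) + \<eta>)) \<longlongrightarrow> ennreal (E * (1 + 0) + 0)) (at_right 0)"
      by (intro tendsto_intros)
    then have "\<forall>\<^sub>F \<eta> in at_right 0. ennreal (E * (1 + \<eta>) + \<eta>) < B"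
      by (rule order_tendstoD) (use B E in simp)
    then have "\<forall>\<^sub>F \<eta>::real in at_right 0. \<eta> > 0 \<and> ennreal (E * (1 + \<eta>) + \<eta>) < B"
      using eventually_at_right_less[of 0] by eventually_elim auto
    from eventually_happens'[OF _ this] show ?thesis using that by auto
  qed
  \<comment> \<open>A pair at distance d > \<open>D * t\<close> loses at most d/D to the spreading
    and d/D to the contraction by \<open>1 - t\<close>. This \<open>D\<close> makes the remaining
    fraction \<open>1 - 2 / D\<close> equal to \<open>exp (- \<eta>)\<close>.\<close>
  define D where "D = 2 / (1 - exp (- \<eta>))"
  have D: "D > 2" "1 - 2 / D = exp (- \<eta>)"
    using \<eta>(1) unfolding D_def by (auto simp: field_simps)
  \<comment> \<open>With \<open>t = exp (- K) / D\<close> one has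
    \<open>2 - ln t = K + (2 + ln D)\<close>, and this \<open>K\<close> makes it at most
    \<open>K * (1 + \<eta>)\<close>.\<close>
  define K where "K = max 1 ((2 + ln D) / \<eta>)"
  have K: "K > 0" "(2 + ln D) \<le> \<eta> * K"
    using \<eta>(1) unfolding K_def by (auto simp: field_simps max_def)
  define t where "t = exp (- K) / D"
  have t: "t > 0" "t \<le> 1 / D" "ln t = - K - ln D" "ln (D * t) = - K" "t < 1"
  proof -
    show "t > 0" "t \<le> 1 / D" using D K unfolding t_def by (auto simp: field_simps)
    then show "t < 1" using D by (smt (verit) divide_less_eq_1_pos)
    show "ln t = - K - ln D" "ln (D * t) = - K" unfolding t_def using D by (simp_all add: ln_div)
  qed
  (* the contraction x |-> (1 - t) x keeps the smoothed measure inside [0,1] *)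
  define v where "v x y = ennreal (1/t) * indicator {(1 - t) * x..(1 - t) * x + t} y" for x y
  have v[measurable]: "case_prod v \<in> borel_measurable (\<mu> \<Otimes>\<^sub>M lborel)"
    unfolding v_def indicator_def atLeastAtMost_iff by measurable
  have bound: "(\<integral>\<^sup>+y. v x y * (\<integral>\<^sup>+y'. v x' y' * lk y y' \<partial>lborel) \<partial>lborel)
      \<le> lk x x' * ennreal (1 + \<eta>) + ennreal \<eta>" for x x'
  proof (cases "\<bar>x - x'\<bar> \<le> D * t")
    case True
    have "(\<integral>\<^sup>+y. v x y * (\<integral>\<^sup>+y'. v x' y' * lk y y' \<partial>lborel) \<partial>lborel) \<le> ennreal (2 - ln t)"
      unfolding v_def by (rule mutual_uniform_energy_le_ln) (use t in auto)
    also have "\<dots> \<le> ennreal (K * (1 + \<eta>))"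
      using K(2) t by (intro ennreal_leI) (auto simp: algebra_simps)
    also have "\<dots> = ennreal K * ennreal (1 + \<eta>)"
      using K \<eta> by (simp add: ennreal_mult)
    also have "ennreal K \<le> lk x x'"
      using lk_ge[OF True] t D by simp
    finally show ?thesis by (simp add: mult_right_mono add_increasing2)
  next
    case False
    let ?d = "\<bar>x - x'\<bar>"
    have d: "0 < ?d" using False t D by (smt (verit) mult_pos_pos)
    have "(\<integral>\<^sup>+y. v x y * (\<integral>\<^sup>+y'. v x' y' * lk y y' \<partial>lborel) \<partial>lborel) \<le> ennreal (max 0 (- ln (?d * exp (- \<eta>))))"
      unfolding v_def
    proof (rule mutual_uniform_energy_le)
      fix y y' assume y: "y \<in> {(1 - t) * x..(1 - t) * x + t}" "y' \<in> {(1 - t) * x'..(1 - t) * x' + t}"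
      have "?d * exp (- \<eta>) = ?d - ?d / D - ?d / D" unfolding D(2)[symmetric] by (simp add: algebra_simps)
      also have "\<dots> \<le> ?d - t * ?d - t"
      proof -
        have "t * ?d \<le> 1 / D * ?d" by (intro mult_right_mono t) auto
        moreover have "t \<le> ?d / D" using False D by (simp add: field_simps)
        ultimately show ?thesis by simp
      qed
      also have "\<dots> = \<bar>(1 - t) * x - (1 - t) * x'\<bar> - t"
        unfolding right_diff_distrib[symmetric] abs_mult using t by (simp add: left_diff_distrib)
      also have "\<dots> \<le> \<bar>y - y'\<bar>" using y by auto
      finally show "lk y y' \<le> ennreal (max 0 (- ln (?d * exp (- \<eta>))))"
        by (intro lk_le) (use d in auto)
    qed (use t in auto)
    also have "\<dots> \<le> ennreal (max 0 (- ln ?d) + \<eta>)"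
      using d \<eta>(1) by (intro ennreal_leI) (auto simp: ln_mult)
    also have "\<dots> = lk x x' * 1 + ennreal \<eta>"
      using d \<eta>(1) by (simp add: lk_def)
    also have "\<dots> \<le> lk x x' * ennreal (1 + \<eta>) + ennreal \<eta>"
      using \<eta>(1) by (intro add_mono mult_left_mono) (auto simp flip: ennreal_1 intro!: ennreal_leI)
    finally show ?thesis .
  qed
  let ?h = "\<lambda>y. \<integral>\<^sup>+x. v x y \<partial>\<mu>"
  let ?\<mu>' = "density lborel ?h"
  have "energy ?\<mu>' \<le> (\<integral>\<^sup>+x. \<integral>\<^sup>+x'. lk x x' * ennreal (1 + \<eta>) + ennreal \<eta> \<partial>\<mu> \<partial>\<mu>)"
    by (subst energy_density_mixture[OF _ v]) (auto intro!: nn_integral_mono bound sigma_finite_measure_axioms)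
  also have "\<dots> = energy \<mu> * ennreal (1 + \<eta>) + ennreal \<eta>"
    unfolding energy_def by (simp add: nn_integral_add nn_integral_multc emeasure_space_1)
  also have "\<dots> = ennreal (E * (1 + \<eta>) + \<eta>)"
    using E \<eta>(1) by (simp add: ennreal_mult)
  finally have "energy ?\<mu>' < B" using \<eta>(2) by simp
  moreover have "prob_space ?\<mu>'"
  proof (rule prob_space_density_mixture)
    show "AE x in \<mu>. (\<integral>\<^sup>+y. v x y \<partial>lborel) = 1"
      unfolding v_def using nn_integral_uniform_const[OF t(1), where C=1] by simp
  qed (fact v prob_space_axioms)+
  moreover have "absolutely_continuous lborel ?\<mu>'"
    by (rule absolutely_continuousI_density) measurable
  moreover have "AE x in ?\<mu>'. x \<in> {0<..<1}"
  proof -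
    have "AE y in ?\<mu>'. y \<in> {0..1}"
    proof (rule AE_density_mixture[OF _ v])
      show "AE x in \<mu>. \<forall>y. y \<notin> {0..1} \<longrightarrow> v x y = 0"
        using AE01
      proof eventually_elim
        case (elim x)
        have "(1 - t) * x \<ge> 0" "(1 - t) * x \<le> (1 - t) * 1" using elim t by (auto intro!: mult_left_mono)
        then show ?case by (auto simp: v_def indicator_def)
      qed
    qed unfold_locales
    \<comment> \<open>Absolute continuity discards the two endpoints; the refinement starts from an
      open set inside (0,1).\<close>
    moreover have "AE y in ?\<mu>'. y \<noteq> 0 \<and> y \<noteq> 1"
      by (subst AE_density, measurable)
         (use AE_lborel_singleton[of 0] AE_lborel_singleton[of 1] in eventually_elim, simp)
    ultimately show ?thesis by eventually_elim auto
  qed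
  ultimately show ?thesis by (intro exI[of _ ?\<mu>']) simp
qed

section \<open>Short intervals: measures of finite energy do not charge the limsup set\<close>

lemma limsup_intervals_AE_not_mem:
  fixes \<mu> :: "real measure" and l :: "nat \<Rightarrow> real"
  assumes "prob_space \<mu>" and sets[measurable_cong]: "sets \<mu> = sets borel"
    and fin: "energy \<mu> < \<infinity>"
    and l: "\<And>k. k \<ge> 1 \<Longrightarrow> 0 < l k \<and> l k < 1"
    and summable: "summable (\<lambda>k. 1 / (- ln (l k)))"
  shows "AE x in \<mu>. x \<notin> limsup_intervals c l"
proof -
  interpret prob_space \<mu> by fact
  let ?I = "\<lambda>k. {c k - l k / 2<..<c k + l k / 2}"
  define U where "U x = (\<integral>\<^sup>+y. lk x y \<partial>\<mu>)" for x
  have [measurable]: "U \<in> borel_measurable borel" unfolding U_def by measurable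
  have "AE x in \<mu>. U x \<noteq> \<infinity>"
    by (rule nn_integral_PInf_AE) (use fin in \<open>auto simp: energy_def U_def\<close>)
  moreover have "AE x in \<mu>. \<forall>N::nat. \<forall>\<^sub>F k in sequentially. x \<notin> ?I k \<inter> {x. U x \<le> ennreal (real N)}"
  proof (subst AE_all_countable, rule allI)
    fix N :: nat
    let ?A = "\<lambda>k. ?I k \<inter> {x. U x \<le> ennreal (real N)}"
    \<comment> \<open>A single point \<open>x\<close> of \<open>?A k\<close> suffices: all of
      \<open>?A k\<close> lies within \<open>l k\<close> of it, so integrating \<open>lk x\<close>
      over \<open>?A k\<close> alone gives at least \<open>- ln (l k)\<close> times its mass, while
      the whole integral is \<open>U x\<close>, at most \<open>N\<close>.\<close>
    have bound: "measure \<mu> (?A k) \<le> real N * (1 / (- ln (l k)))" if k: "k \<ge> 1" for k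
    proof (cases "?A k = {}")
      case True
      have "0 \<le> real N * (1 / (- ln (l k)))"
        using l[OF k] by (intro mult_nonneg_nonneg) (auto simp: divide_nonneg_neg)
      then show ?thesis by (simp only: True measure_empty)
    next
      case False
      then obtain x where x: "x \<in> ?A k" by blast
      have "ennreal (- ln (l k)) * emeasure \<mu> (?A k) = (\<integral>\<^sup>+y. ennreal (- ln (l k)) * indicator (?A k) y \<partial>\<mu>)"
        by (simp add: nn_integral_cmult_indicator sets)
      also have "\<dots> \<le> U x"
        unfolding U_def[of x]
      proof (rule nn_integral_mono)
        fix y show "ennreal (- ln (l k)) * indicator (?A k) y \<le> lk x y"
          using x l[OF k] by (cases "y \<in> ?A k") (auto intro!: lk_ge)
      qed
      also have "\<dots> \<le> ennreal (real N)" using x by simp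
      finally have "- ln (l k) * measure \<mu> (?A k) \<le> real N"
        using l[OF k] by (simp add: emeasure_eq_measure flip: ennreal_mult)
      then show ?thesis using l[OF k] by (simp add: field_simps)
    qed
    show "AE x in \<mu>. \<forall>\<^sub>F k in sequentially. x \<notin> ?A k"
    proof -
      have "AE x in \<mu>. \<forall>\<^sub>F k in sequentially. x \<in> space \<mu> - ?A k"
      proof (rule borel_cantelli_AE1)
        show "summable (\<lambda>k. measure \<mu> (?A k))"
        proof (rule summable_comparison_test')
          show "summable (\<lambda>k. real N * (1 / (- ln (l k))))" by (intro summable_mult summable)
          show "norm (measure \<mu> (?A k)) \<le> real N * (1 / (- ln (l k)))" if "k \<ge> 1" for k
            using bound[OF that] by simp
        qed
      qed (auto simp: sets emeasure_eq_measure)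
      then show ?thesis by (auto elim!: eventually_mono)
    qed
  qed
  ultimately show ?thesis
  proof eventually_elim
    case (elim x)
    obtain r where "U x = ennreal r" "r \<ge> 0" using elim(1) by (cases "U x") auto
    moreover obtain N :: nat where "r \<le> real N" using real_arch_simple by blast
    ultimately have "U x \<le> ennreal (real N)" by (simp add: ennreal_leI)
    then have "\<forall>\<^sub>F k in sequentially. x \<notin> ?I k"
      using elim(2) by (auto elim!: eventually_mono)
    then obtain n where n: "\<And>k. k \<ge> n \<Longrightarrow> x \<notin> ?I k" by (auto simp: eventually_sequentially)
    then have "x \<notin> (\<Union>k\<in>{max 1 n..}. ?I k)" by auto
    then show ?case unfolding limsup_intervals_def by (auto simp del: greaterThanLessThan_iff)
  qed
qed

section \<open>Averages over the blocks of centers\<close>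

lemma sum_pairs_Collect:
  assumes "finite A" "finite B"
  shows "(\<Sum>(i,j)\<in>{(i,j). i \<in> A \<and> j \<in> B \<and> Q i j}. g i j) = (\<Sum>i\<in>A. \<Sum>j\<in>B. if Q i j then g i j else 0)"
proof -
  have "{(i,j). i \<in> A \<and> j \<in> B \<and> Q i j} = {p \<in> A \<times> B. Q (fst p) (snd p)}" by auto
  then show ?thesis
    using assms by (simp add: sum.cartesian_product sum.inter_filter case_prod_beta)
qed

text \<open>Capping the kernel at \<open>- ln d\<close> makes it continuous, so that its averages
  over pairs of centers converge. It is not cut off at 0 from below: nonnegativity is available only
  on [0,1] and for \<open>d \<le> 1\<close>.\<close>

definition lk_trunc :: "real \<Rightarrow> real \<Rightarrow> real \<Rightarrow> real" where
  "lk_trunc d x y = - ln (max \<bar>x - y\<bar> d)"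

lemma continuous_on_lk_trunc [continuous_intros]:
  assumes "0 < d" "continuous_on S f" "continuous_on S g"
  shows "continuous_on S (\<lambda>x. lk_trunc d (f x) (g x))"
  unfolding lk_trunc_def using assms(1) by (intro continuous_intros assms(2,3)) (auto simp: max_def)

lemma lk_trunc_nonneg:
  assumes "0 < d" "d \<le> 1" "x \<in> {0..1}" "y \<in> {0..1}"
  shows "0 \<le> lk_trunc d x y"
proof -
  have "max \<bar>x - y\<bar> d \<le> 1" "0 < max \<bar>x - y\<bar> d" using assms by (auto simp: abs_if)
  then show ?thesis unfolding lk_trunc_def by simp
qed

lemma lk_trunc_le: "0 < d \<Longrightarrow> lk_trunc d x y \<le> - ln d"
  unfolding lk_trunc_def by simp

lemma lk_trunc_le_ln: "0 < d \<Longrightarrow> x \<noteq> y \<Longrightarrow> lk_trunc d x y \<le> - ln \<bar>x - y\<bar>"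
  unfolding lk_trunc_def by simp

lemma ennreal_lk_trunc_le: "0 < d \<Longrightarrow> ennreal (lk_trunc d x y) \<le> lk x y"
  using lk_trunc_le_ln[of d x y] by (auto simp: lk_def intro!: ennreal_leI)

text \<open>Off the diagonal \<open>lk\<close> is reached or exceeded no later than
  \<open>1 / Suc n\<close> drops below the distance; on the diagonal the truncated value
  \<open>ln (Suc n)\<close> is unbounded. This representation yields both monotone convergence and
  lower semicontinuity.\<close>

lemma lk_eq_SUP_trunc: "lk x y = (SUP n. ennreal (lk_trunc (1 / Suc n) x y))"
proof (rule antisym)
  show "(SUP n. ennreal (lk_trunc (1 / Suc n) x y)) \<le> lk x y"
    by (intro SUP_least ennreal_lk_trunc_le) simp
  show "lk x y \<le> (SUP n. ennreal (lk_trunc (1 / Suc n) x y))"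
  proof (cases "x = y")
    case False
    then obtain n where "1 / real (Suc n) < \<bar>x - y\<bar>"
      using nat_approx_posE[of "\<bar>x - y\<bar>"] by auto
    then have "lk x y \<le> ennreal (lk_trunc (1 / Suc n) x y)"
      using False by (auto simp: lk_def lk_trunc_def max_def ennreal_neg)
    then show ?thesis by (meson SUP_upper2 UNIV_I)
  next
    case True
    have "\<exists>n. r < ennreal (lk_trunc (1 / Suc n) x y)" if r: "r < \<infinity>" for r
    proof -
      obtain s where s: "r = ennreal s" "s \<ge> 0" using r by (cases r) auto
      obtain n :: nat where n: "exp s < real n" using reals_Archimedean2 by blast
      then have "s < ln (real (Suc n))"
        by (smt (verit) exp_gt_zero ln_less_cancel_iff ln_exp of_nat_Suc)
      also have "\<dots> = lk_trunc (1 / Suc n) x y"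
        using True unfolding lk_trunc_def by (simp add: ln_div)
      finally show ?thesis using s by (auto intro!: exI[of _ n] ennreal_lessI)
    qed
    then have "(SUP n. ennreal (lk_trunc (1 / Suc n) x y)) = \<infinity>"
      unfolding infinity_ennreal_def SUP_eq_top_iff by blast
    then show ?thesis by (simp only: infinity_ennreal_def top_greatest)
  qed
qed

lemma incseq_lk_trunc: "incseq (\<lambda>n. ennreal (lk_trunc (1 / Suc n) x y))"
proof (intro incseq_SucI ennreal_leI)
  fix n :: nat
  have "max \<bar>x - y\<bar> (1 / Suc (Suc n)) \<le> max \<bar>x - y\<bar> (1 / Suc n)"
    by (intro max.mono order_refl divide_left_mono) auto
  moreover have "0 < max \<bar>x - y\<bar> (1 / Suc (Suc n))"
    by (rule less_le_trans[OF _ max.cobounded2]) simp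
  ultimately show "lk_trunc (1 / Suc n) x y \<le> lk_trunc (1 / Suc (Suc n)) x y"
    unfolding lk_trunc_def by simp
qed

lemma measurable_lk_trunc [measurable (raw)]:
  assumes [measurable]: "f \<in> borel_measurable M" "g \<in> borel_measurable M"
  shows "(\<lambda>x. lk_trunc d (f x) (g x)) \<in> borel_measurable M"
  unfolding lk_trunc_def by measurable

lemma card_blockA [simp]: "card (blockA n) = n"
  by (simp add: blockA_def)

lemma finite_blockA [simp]: "finite (blockA n)"
  by (simp add: blockA_def)

text \<open>The hypotheses in working form, with \<open>P\<close> for the measure \<phi> dx on
  [0,1]. The positivity of \<phi> is encoded in \<open>null_P\<close>; \<open>near_sum\<close> is
  (A2) with the cardinalities multiplied out and iterated sums. Test functions are total, so
  measurability outside [0,1] has to be required separately from continuity on it.\<close>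

locale equidistributed_centers =
  fixes lam :: real and c :: "nat \<Rightarrow> real" and q :: "nat \<Rightarrow> nat" and P :: "real measure"
  assumes lam_pos: "lam > 0"
    and c_range: "\<And>k. k \<ge> 1 \<Longrightarrow> c k \<in> {0<..<1}"
    and prob_P: "prob_space P"
    and sets_P [measurable_cong]: "sets P = sets borel"
    and AE_P: "AE x in P. x \<in> {0..1}"
    and ac_P: "absolutely_continuous lborel P"
    and null_P: "\<And>N. N \<in> null_sets P \<Longrightarrow> N \<inter> {0<..<1} \<in> null_sets lborel"
    and average_tendsto: "\<And>f. continuous_on {0..1} f \<Longrightarrow> f \<in> borel_measurable borel \<Longrightarrow>
          (\<lambda>n. (\<Sum>k\<in>blockA n. f (c k)) / real n) \<longlonglongrightarrow> (\<integral>x. f x \<partial>P)"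
    and q_lim: "filterlim q at_top sequentially"
    and near_sum: "\<And>\<epsilon>. \<epsilon> > 0 \<Longrightarrow> \<exists>\<delta>>0. \<forall>\<^sub>F n in sequentially. \<forall>a b. a \<le> q n \<and> b \<le> q n \<longrightarrow>
          (\<Sum>i\<in>blockA (2^a * n). \<Sum>j\<in>blockA (2^b * n).
             if i \<noteq> j \<and> \<bar>c i - c j\<bar> < \<delta> then - ln \<bar>c i - c j\<bar> else 0)
          < \<epsilon> * (real (2^a * n) * real (2^b * n))"
    and separated: "\<And>\<epsilon>. \<epsilon> > 0 \<Longrightarrow> \<forall>\<^sub>F n in sequentially.
               \<forall>i\<in>blockAq n (q n). \<forall>j\<in>blockAq n (q n). i \<noteq> j \<longrightarrow>
                 exp (- lam * real i) + exp (- lam * real j) < 2 * \<epsilon> * \<bar>c i - c j\<bar>"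
begin

sublocale P: prob_space P by (rule prob_P)

lemma c_blockA: "n \<ge> 1 \<Longrightarrow> k \<in> blockA n \<Longrightarrow> c k \<in> {0<..<1}"
  using c_range[of k] by (auto simp: blockA_def)

lemma integrable_continuous:
  fixes f :: "real \<Rightarrow> real"
  assumes "continuous_on {0..1} f" and [measurable]: "f \<in> borel_measurable borel"
  shows "integrable P f"
proof -
  have "bounded (f ` {0..1})"
    by (intro compact_imp_bounded compact_continuous_image assms) auto
  then obtain B where B: "\<forall>x\<in>{0..1}. norm (f x) \<le> B" by (force simp: bounded_iff)
  have "AE x in P. norm (f x) \<le> B" by (rule eventually_mono[OF AE_P]) (use B in blast)
  then show ?thesis by (rule P.integrable_const_bound) measurable
qed

text \<open>In (A3) the lengths are positive, so the distance is. This has to be recorded because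
  \<open>ln 0\<close> is a real number in HOL: coinciding centers would not show up as an infinite
  kernel in the sums.\<close>

lemma eventually_distinct:
  "\<forall>\<^sub>F n in sequentially. \<forall>i\<in>blockAq n (q n). \<forall>j\<in>blockAq n (q n). i \<noteq> j \<longrightarrow> c i \<noteq> c j"
  using separated[of 1, OF zero_less_one]
proof (rule eventually_mono, intro ballI impI notI)
  fix n i j assume "\<forall>i\<in>blockAq n (q n). \<forall>j\<in>blockAq n (q n). i \<noteq> j \<longrightarrow>
      exp (- lam * real i) + exp (- lam * real j) < 2 * 1 * \<bar>c i - c j\<bar>"
    "i \<in> blockAq n (q n)" "j \<in> blockAq n (q n)" "i \<noteq> j" "c i = c j"
  then have "exp (- lam * real i) + exp (- lam * real j) < 2 * 1 * \<bar>c i - c j\<bar>" by blast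
  moreover have "0 < exp (- lam * real i) + exp (- lam * real j)" by (simp add: add_pos_pos)
  ultimately show False using \<open>c i = c j\<close> by simp
qed

section \<open>Averages of a continuous kernel over pairs of blocks\<close>

context
  fixes F :: "real \<Rightarrow> real \<Rightarrow> real"
  assumes F: "continuous_on UNIV (\<lambda>p. F (fst p) (snd p))"
begin

private lemma measurable_F: "(\<lambda>p. F (fst p) (snd p)) \<in> borel_measurable (borel \<Otimes>\<^sub>M borel)"
  using borel_measurable_continuous_onI[OF F] by (simp add: borel_prod)

private lemma measurable_F1: "F x \<in> borel_measurable borel"
  using measurable_compose[OF measurable_Pair1'[of x borel borel] measurable_F] by simp

private lemma continuous_F1: "continuous_on S (F x)"
proof -
  have "continuous_on S (\<lambda>y. (x, y))" by (intro continuous_intros)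
  from continuous_on_compose2[OF F this] show ?thesis by simp
qed

private lemma integrable_F1: "integrable P (F x)"
  by (intro integrable_continuous continuous_F1 measurable_F1)

private lemma measurable_integral_F: "(\<lambda>x. \<integral>y. F x y \<partial>P) \<in> borel_measurable borel"
proof -
  note [measurable] = measurable_F
  show ?thesis by measurable
qed

private lemma uniform_F:
  assumes "e > 0"
  obtains d where "d > 0" "\<And>x x' y. x \<in> {0..1} \<Longrightarrow> x' \<in> {0..1} \<Longrightarrow> y \<in> {0..1} \<Longrightarrow> \<bar>x - x'\<bar> < d \<Longrightarrow> \<bar>F x y - F x' y\<bar> < e"
proof -
  have "uniformly_continuous_on ({0..1} \<times> {0..1}) (\<lambda>p. F (fst p) (snd p))"
    by (intro compact_uniformly_continuous compact_Times continuous_on_subset[OF F]) auto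
  then obtain d where "d > 0" and d: "\<And>p p'. p \<in> {0..1} \<times> {0..1} \<Longrightarrow> p' \<in> {0..1} \<times> {0..1} \<Longrightarrow> dist p' p < d \<Longrightarrow>
      dist (F (fst p') (snd p')) (F (fst p) (snd p)) < e"
    using \<open>e > 0\<close> unfolding uniformly_continuous_on_def by metis
  show ?thesis
    using that[OF \<open>d > 0\<close>] d[of "(_, _)" "(_, _)"] by (force simp: dist_Pair_Pair dist_real_def)
qed

private lemma integral_F_close:
  assumes "x \<in> {0..1}" "x' \<in> {0..1}" "e > 0" "\<And>y. y \<in> {0..1} \<Longrightarrow> \<bar>F x y - F x' y\<bar> < e"
  shows "\<bar>(\<integral>y. F x y \<partial>P) - (\<integral>y. F x' y \<partial>P)\<bar> \<le> e"
proof -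
  have "\<bar>(\<integral>y. F x y \<partial>P) - (\<integral>y. F x' y \<partial>P)\<bar> = \<bar>\<integral>y. F x y - F x' y \<partial>P\<bar>"
    by (simp add: integrable_F1)
  also have "\<dots> \<le> (\<integral>y. \<bar>F x y - F x' y\<bar> \<partial>P)" by (rule integral_abs_bound)
  also have "\<dots> \<le> (\<integral>y. e \<partial>P)"
    by (intro integral_mono_AE integrable_abs Bochner_Integration.integrable_diff integrable_F1)
       (auto intro!: eventually_mono[OF AE_P] less_imp_le assms(4))
  finally show ?thesis by (simp add: P.prob_space)
qed

private lemma continuous_integral_F: "continuous_on {0..1} (\<lambda>x. \<integral>y. F x y \<partial>P)"
  unfolding continuous_on_iff
proof (intro ballI allI impI)
  fix x e :: real assume x: "x \<in> {0..1}" and "e > 0"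
  obtain d where "d > 0" and d: "\<And>x x' y. x \<in> {0..1} \<Longrightarrow> x' \<in> {0..1} \<Longrightarrow> y \<in> {0..1} \<Longrightarrow> \<bar>x - x'\<bar> < d \<Longrightarrow> \<bar>F x y - F x' y\<bar> < e/2"
    using uniform_F[of "e/2"] \<open>e > 0\<close> by auto
  have "dist (\<integral>y. F x' y \<partial>P) (\<integral>y. F x y \<partial>P) < e" if "x' \<in> {0..1}" "dist x' x < d" for x'
    using integral_F_close[of x' x "e/2"] d[of x' x] that x \<open>e > 0\<close> by (auto simp: dist_real_def)
  then show "\<exists>d>0. \<forall>x'\<in>{0..1}. dist x' x < d \<longrightarrow> dist (\<integral>y. F x' y \<partial>P) (\<integral>y. F x y \<partial>P) < e"
    using \<open>d > 0\<close> by blast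
qed

text \<open>Convergence of the inner averages is made uniform in the outer variable by a finite net
  and uniform continuity; the outer average is then an ordinary one. The two block sizes are
  independent beyond \<open>N\<close>, since later they are \<open>2^a * n\<close> and
  \<open>2^b * n\<close> with unbounded ratio.\<close>

lemma double_average:
  assumes "e > 0"
  shows "\<exists>N. \<forall>n\<ge>N. \<forall>m\<ge>N. \<bar>(\<Sum>i\<in>blockA n. \<Sum>j\<in>blockA m. F (c i) (c j)) / (real n * real m)
            - (\<integral>x. \<integral>y. F x y \<partial>P \<partial>P)\<bar> < e"
proof -
  define e' where "e' = e / 4"
  have e': "e' > 0" using assms by (simp add: e'_def)
  define A where "A n f = (\<Sum>k\<in>blockA n. f (c k)) / real n" for n and f :: "real \<Rightarrow> real"
  define G where "G x = (\<integral>y. F x y \<partial>P)" for x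
  have A_close: "\<bar>A n f - A n g\<bar> \<le> t" if "n \<ge> 1" "\<And>x. x \<in> {0..1} \<Longrightarrow> \<bar>f x - g x\<bar> \<le> t" for n f g t
  proof -
    have "A n f - A n g = (\<Sum>k\<in>blockA n. f (c k) - g (c k)) / real n"
      by (simp add: A_def sum_subtractf diff_divide_distrib)
    moreover have "\<bar>\<Sum>k\<in>blockA n. f (c k) - g (c k)\<bar> \<le> (\<Sum>k\<in>blockA n. t)"
      using c_blockA[OF that(1)] by (intro order_trans[OF sum_abs] sum_mono that(2)) force
    ultimately have "\<bar>A n f - A n g\<bar> \<le> (\<Sum>k\<in>blockA n. t) / real n"
      by (simp add: divide_right_mono del: sum_constant)
    also have "\<dots> = t" using that(1) by simp
    finally show ?thesis .
  qed
  obtain d where "d > 0" and d: "\<And>x x' y. x \<in> {0..1} \<Longrightarrow> x' \<in> {0..1} \<Longrightarrow> y \<in> {0..1} \<Longrightarrow> \<bar>x - x'\<bar> < d \<Longrightarrow> \<bar>F x y - F x' y\<bar> < e'"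
    using uniform_F[OF e'] by metis
  \<comment> \<open>Moving to the nearest net point costs \<open>e'\<close> in the average and
    \<open>e'\<close> in the integral, convergence at the net point a third \<open>e'\<close>; the
    outer average takes the fourth part of \<open>e\<close>.\<close>
  have "{0..1} \<subseteq> (\<Union>x\<in>{0..1::real}. ball x d)" using \<open>d > 0\<close> by auto
  then obtain K :: "real set" where K: "K \<subseteq> {0..1}" "finite K" "{0..1} \<subseteq> (\<Union>x\<in>K. ball x d)"
    using compactE_image[OF compact_Icc[of "0::real" 1], of "{0..1}" "\<lambda>x. ball x d"] by (metis open_ball)
  have "\<forall>\<^sub>F n in sequentially. \<forall>x\<in>K. \<bar>A n (F x) - G x\<bar> < e'"
  proof (intro eventually_ball_finite K ballI)
    fix x assume "x \<in> K"
    have "(\<lambda>n. A n (F x)) \<longlonglongrightarrow> G x"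
      unfolding A_def G_def by (intro average_tendsto continuous_F1 measurable_F1)
    then show "\<forall>\<^sub>F n in sequentially. \<bar>A n (F x) - G x\<bar> < e'"
      using e' unfolding tendsto_iff dist_real_def by blast
  qed
  then obtain N1 where N1: "\<And>n x. n \<ge> N1 \<Longrightarrow> x \<in> K \<Longrightarrow> \<bar>A n (F x) - G x\<bar> < e'"
    by (auto simp: eventually_sequentially)
  have close: "\<bar>A n (F x) - G x\<bar> \<le> 3 * e'" if n: "n \<ge> max 1 N1" and x: "x \<in> {0..1}" for n x
  proof -
    obtain p where p: "p \<in> K" "\<bar>p - x\<bar> < d" using K x by (force simp: dist_real_def)
    have px: "p \<in> {0..1}" using p K by auto
    have "\<bar>A n (F p) - A n (F x)\<bar> \<le> e'"
      using n p x px by (intro A_close less_imp_le[OF d]) auto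
    moreover have "\<bar>G p - G x\<bar> \<le> e'"
      unfolding G_def using p x px e' by (intro integral_F_close d) auto
    moreover have "\<bar>A n (F p) - G p\<bar> < e'" using N1 n p by auto
    ultimately show ?thesis by arith
  qed
  have "(\<lambda>n. A n G) \<longlonglongrightarrow> (\<integral>x. G x \<partial>P)"
    unfolding A_def G_def by (intro average_tendsto continuous_integral_F measurable_integral_F)
  then obtain N2 where N2: "\<And>n. n \<ge> N2 \<Longrightarrow> \<bar>A n G - (\<integral>x. G x \<partial>P)\<bar> < e'"
    using e' unfolding tendsto_iff dist_real_def eventually_sequentially by metis
  show ?thesis
  proof (intro exI allI impI)
    fix n m assume n: "max 1 (max N1 N2) \<le> n" and m: "max 1 (max N1 N2) \<le> m"
    have "(\<Sum>i\<in>blockA n. \<Sum>j\<in>blockA m. F (c i) (c j)) / (real n * real m) = A n (\<lambda>x. A m (F x))"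
      by (simp add: A_def field_simps flip: sum_divide_distrib)
    moreover have "\<bar>A n (\<lambda>x. A m (F x)) - A n G\<bar> \<le> 3 * e'"
      using n m by (intro A_close close) auto
    moreover have "\<bar>A n G - (\<integral>x. G x \<partial>P)\<bar> < e'" using N2 n by auto
    ultimately have "\<bar>(\<Sum>i\<in>blockA n. \<Sum>j\<in>blockA m. F (c i) (c j)) / (real n * real m) - (\<integral>x. G x \<partial>P)\<bar> < 4 * e'"
      by arith
    then show "\<bar>(\<Sum>i\<in>blockA n. \<Sum>j\<in>blockA m. F (c i) (c j)) / (real n * real m)
            - (\<integral>x. \<integral>y. F x y \<partial>P \<partial>P)\<bar> < e"
      by (simp add: G_def e'_def)
  qed
qed

lemma nn_integral_iterated_eq:
  assumes "\<And>x y. x \<in> {0..1} \<Longrightarrow> y \<in> {0..1} \<Longrightarrow> 0 \<le> F x y"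
  shows "(\<integral>\<^sup>+x. \<integral>\<^sup>+y. ennreal (F x y) \<partial>P \<partial>P) = ennreal (\<integral>x. \<integral>y. F x y \<partial>P \<partial>P)"
proof -
  have nn: "AE y in P. 0 \<le> F x y" if "x \<in> {0..1}" for x
    by (rule eventually_mono[OF AE_P]) (use assms that in blast)
  have "(\<integral>\<^sup>+x. \<integral>\<^sup>+y. ennreal (F x y) \<partial>P \<partial>P) = (\<integral>\<^sup>+x. ennreal (\<integral>y. F x y \<partial>P) \<partial>P)"
    by (rule nn_integral_cong_AE, rule eventually_mono[OF AE_P]) (intro nn_integral_eq_integral integrable_F1 nn)
  also have "\<dots> = ennreal (\<integral>x. \<integral>y. F x y \<partial>P \<partial>P)"
    by (intro nn_integral_eq_integral integrable_continuous continuous_integral_F measurable_integral_F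
          eventually_mono[OF AE_P] integral_nonneg_AE nn)
  finally show ?thesis .
qed

end

text \<open>The truncated energy is compared with the average of the truncated kernel over pairs
  from one block. Near pairs are controlled by (A2) with tolerance 1, far pairs by
  \<open>- ln \<delta>\<close>, and the diagonal costs \<open>- ln d / n\<close>, at most 1 for
  large \<open>n\<close>. The bound does not depend on \<open>d\<close>, so monotone convergence
  applies.\<close>

lemma energy_P_finite: "energy P < \<infinity>"
proof -
  obtain \<delta> where "\<delta> > 0" and near: "\<forall>\<^sub>F n in sequentially. \<forall>a b. a \<le> q n \<and> b \<le> q n \<longrightarrow>
          (\<Sum>i\<in>blockA (2^a * n). \<Sum>j\<in>blockA (2^b * n).
             if i \<noteq> j \<and> \<bar>c i - c j\<bar> < \<delta> then - ln \<bar>c i - c j\<bar> else 0)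
          < 1 * (real (2^a * n) * real (2^b * n))"
    using near_sum[of 1] by auto
  \<comment> \<open>The 3 collects 1 from near pairs, 1 from the diagonal, and 1 from replacing the
    average by the integral.\<close>
  define C where "C = 3 + max 0 (- ln \<delta>)"
  have bound: "(\<integral>x. \<integral>y. lk_trunc d x y \<partial>P \<partial>P) \<le> C" if d: "0 < d" "d \<le> 1" for d
  proof -
    have cont: "continuous_on UNIV (\<lambda>p. lk_trunc d (fst p) (snd p))"
      using d by (intro continuous_intros)
    obtain N where N: "\<And>n m. n \<ge> N \<Longrightarrow> m \<ge> N \<Longrightarrow> \<bar>(\<Sum>i\<in>blockA n. \<Sum>j\<in>blockA m. lk_trunc d (c i) (c j)) / (real n * real m)
            - (\<integral>x. \<integral>y. lk_trunc d x y \<partial>P \<partial>P)\<bar> < 1"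
      using double_average[OF cont, of 1] by auto
    have "\<forall>\<^sub>F n in sequentially. n \<ge> max 1 (max N (nat \<lceil>- ln d\<rceil>))"
      by (rule eventually_ge_at_top)
    with near eventually_distinct obtain n where n: "n \<ge> 1" "n \<ge> N" "- ln d \<le> real n"
      and near: "(\<Sum>i\<in>blockA n. \<Sum>j\<in>blockA n.
             if i \<noteq> j \<and> \<bar>c i - c j\<bar> < \<delta> then - ln \<bar>c i - c j\<bar> else 0) < real n * real n"
      and sep: "\<And>i j. i \<in> blockA n \<Longrightarrow> j \<in> blockA n \<Longrightarrow> i \<noteq> j \<Longrightarrow> c i \<noteq> c j"
    proof -
      assume *: "\<And>n. 1 \<le> n \<Longrightarrow> N \<le> n \<Longrightarrow> - ln d \<le> real n \<Longrightarrow>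
          (\<Sum>i\<in>blockA n. \<Sum>j\<in>blockA n. if i \<noteq> j \<and> \<bar>c i - c j\<bar> < \<delta> then - ln \<bar>c i - c j\<bar> else 0) < real n * real n \<Longrightarrow>
          (\<And>i j. i \<in> blockA n \<Longrightarrow> j \<in> blockA n \<Longrightarrow> i \<noteq> j \<Longrightarrow> c i \<noteq> c j) \<Longrightarrow> thesis"
      assume "\<forall>\<^sub>F n in sequentially. n \<ge> max 1 (max N (nat \<lceil>- ln d\<rceil>))"
      with near eventually_distinct have "\<forall>\<^sub>F n in sequentially. thesis"
      proof eventually_elim
        case (elim n)
        have "blockA n \<subseteq> blockAq n (q n)" by (force simp: blockAq_def)
        then have "c i \<noteq> c j" if "i \<in> blockA n" "j \<in> blockA n" "i \<noteq> j" for i j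
          using elim(2) that by blast
        then show ?case
          using elim(1)[rule_format, of 0 0] elim(3) by (intro *[of n]) (auto simp: nat_le_iff ceiling_le_iff)
      qed
      then show thesis by simp
    qed
    have "(\<Sum>i\<in>blockA n. \<Sum>j\<in>blockA n. lk_trunc d (c i) (c j))
       \<le> (\<Sum>i\<in>blockA n. \<Sum>j\<in>blockA n. (if i = j then - ln d else 0)
            + (if i \<noteq> j \<and> \<bar>c i - c j\<bar> < \<delta> then - ln \<bar>c i - c j\<bar> else 0) + max 0 (- ln \<delta>))"
    proof (intro sum_mono)
      fix i j assume ij: "i \<in> blockA n" "j \<in> blockA n"
      show "lk_trunc d (c i) (c j) \<le> (if i = j then - ln d else 0)
            + (if i \<noteq> j \<and> \<bar>c i - c j\<bar> < \<delta> then - ln \<bar>c i - c j\<bar> else 0) + max 0 (- ln \<delta>)"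
      proof (cases "i = j")
        case True then show ?thesis using lk_trunc_le[OF d(1), of "c i" "c j"] by simp
      next
        case False
        have "- ln \<bar>c i - c j\<bar> \<le> - ln \<delta>" if "\<not> \<bar>c i - c j\<bar> < \<delta>" using that \<open>\<delta> > 0\<close> by simp
        then show ?thesis using False lk_trunc_le_ln[OF d(1) sep[OF ij False]] by auto
      qed
    qed
    also have "\<dots> = real n * (- ln d) + (\<Sum>i\<in>blockA n. \<Sum>j\<in>blockA n.
             if i \<noteq> j \<and> \<bar>c i - c j\<bar> < \<delta> then - ln \<bar>c i - c j\<bar> else 0) + real n * (real n * max 0 (- ln \<delta>))"
      by (simp add: sum.distrib sum_subtractf)
    also have "\<dots> \<le> real n * real n + real n * real n + real n * (real n * max 0 (- ln \<delta>))"
      using near n by (intro add_mono mult_left_mono) auto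
    also have "\<dots> = (C - 1) * (real n * real n)"
      by (simp add: C_def algebra_simps)
    finally have "(\<Sum>i\<in>blockA n. \<Sum>j\<in>blockA n. lk_trunc d (c i) (c j)) / (real n * real n) \<le> C - 1"
      using n by (simp add: pos_divide_le_eq)
    then show ?thesis using N[OF n(2) n(2)] by linarith
  qed
  have "energy P = (\<integral>\<^sup>+x. \<integral>\<^sup>+y. (SUP n. ennreal (lk_trunc (1 / Suc n) x y)) \<partial>P \<partial>P)"
    unfolding energy_def lk_eq_SUP_trunc ..
  also have "\<dots> = (SUP n. \<integral>\<^sup>+x. \<integral>\<^sup>+y. ennreal (lk_trunc (1 / Suc n) x y) \<partial>P \<partial>P)"
  proof -
    have "(\<integral>\<^sup>+x. \<integral>\<^sup>+y. (SUP n. ennreal (lk_trunc (1 / Suc n) x y)) \<partial>P \<partial>P)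
        = (\<integral>\<^sup>+x. (SUP n. \<integral>\<^sup>+y. ennreal (lk_trunc (1 / Suc n) x y) \<partial>P) \<partial>P)"
    proof (rule nn_integral_cong, rule nn_integral_monotone_convergence_SUP)
      show "incseq (\<lambda>n y. ennreal (lk_trunc (1 / Suc n) x y))" for x
        using incseq_lk_trunc unfolding incseq_def le_fun_def by blast
    qed measurable
    also have "\<dots> = (SUP n. \<integral>\<^sup>+x. \<integral>\<^sup>+y. ennreal (lk_trunc (1 / Suc n) x y) \<partial>P \<partial>P)"
    proof (rule nn_integral_monotone_convergence_SUP)
      show "incseq (\<lambda>n x. \<integral>\<^sup>+y. ennreal (lk_trunc (1 / Suc n) x y) \<partial>P)"
        unfolding incseq_def le_fun_def
        by (intro allI impI nn_integral_mono incseqD[OF incseq_lk_trunc])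
    qed measurable
    finally show ?thesis .
  qed
  also have "\<dots> \<le> ennreal C"
  proof (rule SUP_least)
    fix n
    have "(\<integral>\<^sup>+x. \<integral>\<^sup>+y. ennreal (lk_trunc (1 / Suc n) x y) \<partial>P \<partial>P) = ennreal (\<integral>x. \<integral>y. lk_trunc (1 / Suc n) x y \<partial>P \<partial>P)"
      by (intro nn_integral_iterated_eq lk_trunc_nonneg continuous_intros) auto
    also have "\<dots> \<le> ennreal C" by (intro ennreal_leI bound) auto
    finally show "(\<integral>\<^sup>+x. \<integral>\<^sup>+y. ennreal (lk_trunc (1 / Suc n) x y) \<partial>P \<partial>P) \<le> ennreal C" .
  qed
  finally show ?thesis by (simp add: le_less_trans)
qed

end

section \<open>Approximation by continuous weights\<close>

text \<open>The energy of the measure f dP, where \<open>f\<close> need not have mass 1. It is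
  quadratic in \<open>f\<close>, hence the later comparison with the square of the mass.\<close>

definition weighted_energy :: "real measure \<Rightarrow> (real \<Rightarrow> ennreal) \<Rightarrow> ennreal" where
  "weighted_energy P f = (\<integral>\<^sup>+x. f x * (\<integral>\<^sup>+y. f y * lk x y \<partial>P) \<partial>P)"

lemma weighted_energy_mono:
  "(\<And>x. f x \<le> g x) \<Longrightarrow> weighted_energy P f \<le> weighted_energy P g"
  unfolding weighted_energy_def by (intro nn_integral_mono mult_mono) auto

lemma energy_density:
  assumes "sigma_finite_measure P" and [measurable_cong]: "sets P = sets borel" and [measurable]: "f \<in> borel_measurable borel"
  shows "energy (density P f) = weighted_energy P f"
proof -
  interpret sigma_finite_measure P by fact
  show ?thesis unfolding energy_def weighted_energy_def by (simp add: nn_integral_density)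
qed

text \<open>Dominated convergence is applied twice, with majorants \<open>M\<close> times the kernel
  and \<open>M\<close> times \<open>M\<close> times the potential of \<open>P\<close>. Finite energy
  of \<open>P\<close> makes both integrable, the inner one for almost every
  \<open>x\<close>.\<close>

lemma tendsto_weighted_energy:
  fixes f :: "nat \<Rightarrow> real \<Rightarrow> real"
  assumes "sigma_finite_measure P" and sets_P[measurable_cong]: "sets P = sets borel" and fin: "energy P < \<infinity>"
    and [measurable]: "\<And>n. f n \<in> borel_measurable borel" "g \<in> borel_measurable borel"
    and f: "\<And>n x. f n x \<le> M" and lim: "AE x in P. (\<lambda>n. f n x) \<longlonglongrightarrow> g x"
  shows "(\<lambda>n. weighted_energy P (\<lambda>x. ennreal (f n x))) \<longlonglongrightarrow> weighted_energy P (\<lambda>x. ennreal (g x))"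
proof -
  interpret sigma_finite_measure P by fact
  let ?U = "\<lambda>h x. \<integral>\<^sup>+y. ennreal (h y) * lk x y \<partial>P"
  have lim': "AE x in P. (\<lambda>n. ennreal (f n x)) \<longlonglongrightarrow> ennreal (g x)"
    using lim by eventually_elim (rule tendsto_ennrealI)
  have U_finite: "AE x in P. (\<integral>\<^sup>+y. lk x y \<partial>P) \<noteq> \<infinity>"
    by (rule nn_integral_PInf_AE) (use fin in \<open>auto simp: energy_def\<close>)
  have inner: "AE x in P. (\<lambda>n. ?U (f n) x) \<longlonglongrightarrow> ?U g x \<and> ?U g x \<noteq> \<infinity>"
    using U_finite
  proof eventually_elim
    case (elim x)
    have lk_finite: "AE y in P. lk x y \<noteq> \<infinity>"
      by (rule nn_integral_PInf_AE) (use elim in auto)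
    have dom: "(\<integral>\<^sup>+y. ennreal M * lk x y \<partial>P) < \<infinity>"
      using elim by (simp add: nn_integral_cmult ennreal_mult_less_top top.not_eq_extremum)
    have "(\<lambda>n. ?U (f n) x) \<longlonglongrightarrow> ?U g x"
    proof (rule nn_integral_dominated_convergence[OF _ _ _ _ dom])
      show "AE y in P. (\<lambda>n. ennreal (f n y) * lk x y) \<longlonglongrightarrow> ennreal (g y) * lk x y"
        using lim' lk_finite by eventually_elim (intro tendsto_mult_ennreal tendsto_const, auto)
    qed (auto intro!: AE_I2 mult_right_mono ennreal_leI f)
    moreover have "?U g x \<noteq> \<infinity>"
    proof -
      have "?U g x \<le> (\<integral>\<^sup>+y. ennreal M * lk x y \<partial>P)"
      proof (rule nn_integral_mono_AE, use lim in eventually_elim)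
        case (elim y)
        then have "g y \<le> M" by (rule LIMSEQ_le_const2) (use f in auto)
        then show ?case by (intro mult_right_mono ennreal_leI) auto
      qed
      with dom show ?thesis by (auto simp: top_unique)
    qed
    ultimately show ?case ..
  qed
  have dom: "(\<integral>\<^sup>+x. ennreal M * (\<integral>\<^sup>+y. ennreal M * lk x y \<partial>P) \<partial>P) < \<infinity>"
    using fin by (simp add: nn_integral_cmult ennreal_mult_less_top energy_def)
  show ?thesis
    unfolding weighted_energy_def
  proof (rule nn_integral_dominated_convergence[OF _ _ _ _ dom])
    show "AE x in P. (\<lambda>n. ennreal (f n x) * ?U (f n) x) \<longlonglongrightarrow> ennreal (g x) * ?U g x"
      using lim' inner by eventually_elim (intro tendsto_mult_ennreal, auto)
    show "AE x in P. ennreal (f n x) * ?U (f n) x \<le> ennreal M * (\<integral>\<^sup>+y. ennreal M * lk x y \<partial>P)" for n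
      by (intro AE_I2 mult_mono nn_integral_mono ennreal_leI f) auto
  qed measurable
qed

text \<open>A continuous a.e. approximation is clamped to [0,M] and multiplied by a cutoff supported
  away from the complement of \<open>U\<close>. The margin \<open>\<rho>\<close> later keeps short
  intervals around centers with nonzero weight inside \<open>U\<close>.\<close>

lemma continuous_approximation_in_open:
  fixes g :: "real \<Rightarrow> real"
  assumes U: "open U" "U \<noteq> UNIV" and [measurable]: "g \<in> borel_measurable borel"
    and g: "\<And>x. 0 \<le> g x" "\<And>x. g x \<le> M" "\<And>x. x \<notin> U \<Longrightarrow> g x = 0"
  shows "\<exists>f :: nat \<Rightarrow> real \<Rightarrow> real. (\<forall>n. continuous_on UNIV (f n) \<and> (\<forall>x. 0 \<le> f n x \<and> f n x \<le> M) \<and>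
      (\<exists>\<rho>>0. \<forall>x. f n x \<noteq> 0 \<longrightarrow> ball x \<rho> \<subseteq> U)) \<and>
    (AE x in lborel. (\<lambda>n. f n x) \<longlonglongrightarrow> g x)"
proof -
  have M: "0 \<le> M" using g(1,2) order_trans by blast
  have "g measurable_on UNIV"
    by (rule lebesgue_measurable_imp_measurable_on_nnreal) (use g in \<open>auto intro: measurable_completion\<close>)
  then obtain N h where N: "negligible N" and h: "\<And>n. continuous_on UNIV (h n)"
    and h_lim: "\<And>x. x \<notin> N \<Longrightarrow> (\<lambda>n. h n x) \<longlonglongrightarrow> g x"
    unfolding measurable_on_def by auto
  \<comment> \<open>Zero up to distance 1/n from the complement, one from distance 2/n on. The
    complement must be nonempty because \<open>infdist\<close> to the empty set is 0, which would
    make the cutoff vanish everywhere.\<close>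
  define cut where "cut n x = max 0 (min 1 (real n * infdist x (- U) - 1))" for n x
  define f where "f n x = cut n x * max 0 (min M (h n x))" for n x
  have cut: "0 \<le> cut n x" "cut n x \<le> 1" for n x unfolding cut_def by auto
  show ?thesis
  proof (intro exI[of _ f] conjI allI)
    show "continuous_on UNIV (f n)" for n
      unfolding f_def cut_def by (intro continuous_intros h)
    show "0 \<le> f n x" for n x unfolding f_def by (intro mult_nonneg_nonneg cut) auto
    have "f n x \<le> 1 * M" for n x
      unfolding f_def by (intro mult_mono cut) (use M in auto)
    then show "f n x \<le> M" for n x by simp
    show "\<exists>\<rho>>0. \<forall>x. f n x \<noteq> 0 \<longrightarrow> ball x \<rho> \<subseteq> U" for n
    proof (intro exI[of _ "1 / real (Suc n)"] conjI allI impI subsetI)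
      fix x y assume "f n x \<noteq> 0" and y: "y \<in> ball x (1 / real (Suc n))"
      then have "cut n x \<noteq> 0" unfolding f_def by auto
      then have "1 < real n * infdist x (- U)" unfolding cut_def by (auto simp: max_def min_def split: if_splits)
      also have "\<dots> \<le> real (Suc n) * infdist x (- U)" by (intro mult_right_mono infdist_nonneg) auto
      finally have "1 / real (Suc n) < infdist x (- U)" by (simp add: field_simps)
      then have "dist x y < infdist x (- U)" using y by simp
      then show "y \<in> U" using infdist_le[of y "- U" x] by force
    qed auto
    have "N \<in> null_sets lebesgue" using N by (simp add: negligible_iff_null_sets)
    then have "AE x in lborel. x \<notin> N" 
      by (metis AE_completion_iff AE_not_in)
    then show "AE x in lborel. (\<lambda>n. f n x) \<longlonglongrightarrow> g x"
    proof eventually_elim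
      case (elim x)
      show ?case
      proof (cases "x \<in> U")
        case False
        then have "infdist x (- U) = 0" by simp
        then show ?thesis using g(3)[OF False] by (simp add: f_def cut_def)
      next
        case True
        then have pos: "infdist x (- U) > 0"
          using U by (intro infdist_pos_not_in_closed) auto
        have "filterlim (\<lambda>n. real n * infdist x (- U)) at_top sequentially"
          by (rule filterlim_at_top_mult_tendsto_pos[OF tendsto_const pos filterlim_real_sequentially])
        then have "\<forall>\<^sub>F n in sequentially. real n * infdist x (- U) \<ge> 2"
          by (simp add: filterlim_at_top)
        then have "\<forall>\<^sub>F n in sequentially. cut n x = 1"
          by eventually_elim (auto simp: cut_def)
        then have "(\<lambda>n. cut n x) \<longlonglongrightarrow> 1" by (rule tendsto_eventually)
        then have "(\<lambda>n. f n x) \<longlonglongrightarrow> 1 * max 0 (min M (g x))"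
          unfolding f_def by (intro tendsto_intros h_lim elim)
        then show ?thesis using g(1,2)[of x] by simp
      qed
    qed
  qed
qed

context equidistributed_centers
begin

text \<open>Here the positivity of the limit density enters: a \<open>P\<close>-null set meets (0,1)
  in a Lebesgue null set.\<close>

lemma absolutely_continuous_P:
  assumes "sets \<mu> = sets borel" "absolutely_continuous lborel \<mu>" "AE x in \<mu>. x \<in> {0<..<1}"
  shows "absolutely_continuous P \<mu>"
  unfolding absolutely_continuous_def
proof
  fix N assume N: "N \<in> null_sets P"
  then have "N \<inter> {0<..<1} \<in> null_sets \<mu>"
    using null_P assms(2) by (auto simp: absolutely_continuous_def)
  then have "AE x in \<mu>. x \<notin> N \<inter> {0<..<1}" by (rule AE_not_in)
  with assms(3) have "AE x in \<mu>. x \<notin> N" by eventually_elim auto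
  moreover have "N \<in> sets \<mu>" using N assms(1) sets_P by auto
  ultimately show "N \<in> null_sets \<mu>" by (simp add: AE_iff_null_sets)
qed

text \<open>The density of \<open>\<mu>\<close> relative to \<open>P\<close> is truncated at height
  \<open>m\<close>, which only lowers the energy while the mass tends to 1; the bounded truncation
  is then replaced by continuous weights. The masses are not renormalized: the factor
  \<open>b * (\<integral>x. f x \<partial>P)\<^sup>2\<close> absorbs them.\<close>

lemma continuous_weight:
  fixes b :: real
  assumes "prob_space \<mu>" "sets \<mu> = sets borel" "absolutely_continuous lborel \<mu>"
    and U: "open U" "U \<subseteq> {0<..<1}" "AE x in \<mu>. x \<in> U" and "energy \<mu> < ennreal b"
  obtains f :: "real \<Rightarrow> real" and M \<rho> :: real where
    "continuous_on UNIV f" "\<And>x. 0 \<le> f x" "\<And>x. f x \<le> M" "\<rho> > 0"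
    "\<And>x. f x \<noteq> 0 \<Longrightarrow> ball x \<rho> \<subseteq> U"
    "weighted_energy P (\<lambda>x. ennreal (f x)) < ennreal (b * (\<integral>x. f x \<partial>P)\<^sup>2)"
proof -
  interpret \<mu>: prob_space \<mu> by fact
  note [measurable_cong] = assms(2)
  define h where "h = RN_deriv P \<mu>"
  have [measurable]: "h \<in> borel_measurable borel"
    using borel_measurable_RN_deriv[of P \<mu>] unfolding h_def by (simp add: measurable_cong_sets[OF sets_P refl])
  have dens: "density P h = \<mu>"
    unfolding h_def using assms U(2,3)
    by (intro P.density_RN_deriv absolutely_continuous_P) (auto simp: sets_P elim!: eventually_mono)
  define g where "g m x = enn2real (min (h x) (of_nat m)) * indicator U x" for m :: nat and x
  have Um[measurable]: "U \<in> sets borel" using U by auto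
  have g_measurable [measurable]: "g m \<in> borel_measurable borel" for m unfolding g_def by measurable
  have g_eq: "ennreal (g m x) = min (h x) (of_nat m) * indicator U x" for m x
  proof -
    have "min (h x) (of_nat m) < top" by (rule le_less_trans[OF min.cobounded2 of_nat_less_top])
    then show ?thesis unfolding g_def by (cases "x \<in> U") simp_all
  qed
  have g: "0 \<le> g m x" "g m x \<le> real m" "x \<notin> U \<Longrightarrow> g m x = 0" for m x
    unfolding g_def by (auto simp: indicator_def intro!: enn2real_leI simp flip: ennreal_of_nat_eq_real_of_nat)
  have g_int: "integrable P (g m)" for m
    by (rule P.integrable_const_bound[of _ "real m"]) (use g in auto)
  obtain e0 where e0: "energy \<mu> = ennreal e0" "0 \<le> e0" "e0 < b"
    using \<open>energy \<mu> < ennreal b\<close> by (cases "energy \<mu>") (auto simp: ennreal_less_iff)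
  have "(\<lambda>m. ennreal (\<integral>x. g m x \<partial>P)) \<longlonglongrightarrow> ennreal 1"
  proof -
    have "(\<lambda>m. \<integral>\<^sup>+x. ennreal (g m x) \<partial>P) \<longlonglongrightarrow> (\<integral>\<^sup>+x. h x * indicator U x \<partial>P)"
    proof (rule nn_integral_LIMSEQ)
      show "incseq (\<lambda>m x. ennreal (g m x))"
        unfolding g_eq by (auto simp: incseq_def le_fun_def intro!: mult_right_mono min.mono)
      fix x
      have "(\<lambda>m. min (h x) (of_nat m)) \<longlonglongrightarrow> min (h x) \<infinity>"
        by (intro tendsto_min tendsto_const) (simp add: of_nat_tendsto_top_ennreal)
      then show "(\<lambda>m. ennreal (g m x)) \<longlonglongrightarrow> h x * indicator U x"
        unfolding g_eq by (cases "x \<in> U") (auto simp: min_def)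
    qed measurable
    also have "(\<integral>\<^sup>+x. h x * indicator U x \<partial>P) = emeasure \<mu> U"
      unfolding dens[symmetric] by (simp add: emeasure_density sets_P)
    also have "\<dots> = 1"
      using U(3) assms(2) by (intro \<mu>.emeasure_eq_1_AE) auto
    finally show ?thesis using g by (simp add: nn_integral_eq_integral[OF g_int])
  qed
  then have "(\<lambda>m. \<integral>x. g m x \<partial>P) \<longlonglongrightarrow> 1"
    by (subst (asm) tendsto_ennreal_iff) (auto intro!: always_eventually Bochner_Integration.integral_nonneg g)
  then have "(\<lambda>m. b * (\<integral>x. g m x \<partial>P)\<^sup>2) \<longlonglongrightarrow> b * 1\<^sup>2"
    by (intro tendsto_intros)
  then have "\<forall>\<^sub>F m in sequentially. e0 < b * (\<integral>x. g m x \<partial>P)\<^sup>2"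
    by (rule order_tendstoD) (use e0 in simp)
  then obtain m where m: "e0 < b * (\<integral>x. g m x \<partial>P)\<^sup>2"
    using eventually_happens'[OF sequentially_bot] by blast
  have "weighted_energy P (\<lambda>x. ennreal (g m x)) \<le> weighted_energy P h"
    by (rule weighted_energy_mono) (auto simp: g_eq indicator_def)
  also have "\<dots> = ennreal e0"
    using energy_density[of P h] P.sigma_finite_measure_axioms sets_P by (simp add: dens e0)
  finally have I_g: "weighted_energy P (\<lambda>x. ennreal (g m x)) \<le> ennreal e0" .
  have U': "U \<noteq> UNIV" using U(2) by (metis UNIV_I greaterThanLessThan_iff less_irrefl subsetD)
  obtain f :: "nat \<Rightarrow> real \<Rightarrow> real" where f: "\<And>n. continuous_on UNIV (f n)" "\<And>n x. 0 \<le> f n x" "\<And>n x. f n x \<le> real m"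
    "\<And>n. \<exists>\<rho>>0. \<forall>x. f n x \<noteq> 0 \<longrightarrow> ball x \<rho> \<subseteq> U"
    "AE x in lborel. (\<lambda>n. f n x) \<longlonglongrightarrow> g m x"
    using continuous_approximation_in_open[OF U(1) U' g_measurable g, of m] by blast
  have [measurable]: "f n \<in> borel_measurable borel" for n
    using f(1) by (rule borel_measurable_continuous_onI)
  have AE_f: "AE x in P. (\<lambda>n. f n x) \<longlonglongrightarrow> g m x"
    by (rule absolutely_continuous_AE[OF _ ac_P f(5)]) (simp add: sets_P)
  have "(\<lambda>n. \<integral>x. f n x \<partial>P) \<longlonglongrightarrow> (\<integral>x. g m x \<partial>P)"
    by (rule integral_dominated_convergence[where w="\<lambda>_. real m"]) (use AE_f f in auto)
  then have "(\<lambda>n. b * (\<integral>x. f n x \<partial>P)\<^sup>2) \<longlonglongrightarrow> b * (\<integral>x. g m x \<partial>P)\<^sup>2"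
    by (intro tendsto_intros)
  \<comment> \<open>A value strictly inside the gap separates the two limits: eventually the
    energies are below \<open>r\<close> and the scaled squared masses above it.\<close>
  moreover obtain r where r: "e0 < r" "r < b * (\<integral>x. g m x \<partial>P)\<^sup>2"
    using dense[OF m] by auto
  ultimately have "\<forall>\<^sub>F n in sequentially. r < b * (\<integral>x. f n x \<partial>P)\<^sup>2"
    by (auto dest: order_tendstoD)
  moreover have "\<forall>\<^sub>F n in sequentially. weighted_energy P (\<lambda>x. ennreal (f n x)) < ennreal r"
  proof (rule order_tendstoD)
    show "(\<lambda>n. weighted_energy P (\<lambda>x. ennreal (f n x))) \<longlonglongrightarrow> weighted_energy P (\<lambda>x. ennreal (g m x))"
      by (intro tendsto_weighted_energy[where M="real m"] f(3) AE_f energy_P_finite sets_P P.sigma_finite_measure_axioms) measurable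
    show "weighted_energy P (\<lambda>x. ennreal (g m x)) < ennreal r"
      using I_g r e0 by (auto simp: ennreal_less_iff intro: le_less_trans)
  qed
  ultimately have "\<forall>\<^sub>F n in sequentially. weighted_energy P (\<lambda>x. ennreal (f n x)) < ennreal (b * (\<integral>x. f n x \<partial>P)\<^sup>2)"
    by eventually_elim (erule less_le_trans, auto intro!: ennreal_leI)
  then obtain n where "weighted_energy P (\<lambda>x. ennreal (f n x)) < ennreal (b * (\<integral>x. f n x \<partial>P)\<^sup>2)"
    using eventually_happens'[OF sequentially_bot] by blast
  moreover obtain \<rho> where "\<rho> > 0" "\<And>x. f n x \<noteq> 0 \<Longrightarrow> ball x \<rho> \<subseteq> U"
    using f(4)[of n] by blast
  ultimately show ?thesis using f that by blast
qed

end

section \<open>The discretized energy\<close>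

lemma blockA_disjoint:
  assumes "i \<in> blockA (2^a * n)" "i \<in> blockA (2^b * n)"
  shows "a = b"
proof -
  have le: "False" if "a < b" "i \<in> blockA (2^a * n)" "i \<in> blockA (2^b * n)" for a b :: nat
  proof -
    have "(2::nat) ^ Suc a \<le> 2 ^ b" using that(1) by (intro power_increasing) auto
    then have "2 ^ Suc a * n \<le> 2 ^ b * n" by (rule mult_right_mono) simp
    moreover have "i < 2 ^ Suc a * n" "2 ^ b * n \<le> i" using that(2,3) by (auto simp: blockA_def)
    ultimately show False by linarith
  qed
  show ?thesis using le[of a b] le[of b a] assms by (meson linorder_neqE_nat)
qed

lemma blockA_subset_blockAq: "a \<le> Q \<Longrightarrow> blockA (2^a * n) \<subseteq> blockAq n Q"
  unfolding blockAq_def by auto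

context equidistributed_centers
begin

lemma off_diagonal_sum:
  fixes f :: "real \<Rightarrow> real"
  assumes f: "continuous_on UNIV f" "\<And>x. 0 \<le> f x" "\<And>x. f x \<le> M"
    and E: "weighted_energy P (\<lambda>x. ennreal (f x)) \<le> ennreal E" "0 \<le> E" and "e > 0"
  shows "\<forall>\<^sub>F n in sequentially. \<forall>a b. a \<le> q n \<and> b \<le> q n \<longrightarrow>
     (\<Sum>i\<in>blockA (2^a * n). \<Sum>j\<in>blockA (2^b * n). if i \<noteq> j then f (c i) * f (c j) * (- ln \<bar>c i - c j\<bar>) else 0)
      \<le> (E + e) * (real (2^a * n) * real (2^b * n))"
proof -
  note [measurable] = borel_measurable_continuous_onI[OF f(1)]
  \<comment> \<open>Half of \<open>e\<close> is reserved for near pairs, whose weights are at most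
    \<open>M\<^sup>2\<close>, and half for the convergence of averages; the added 1 covers
    \<open>M = 0\<close>.\<close>
  have "e / (2 * (M\<^sup>2 + 1)) > 0" using \<open>e > 0\<close> by (intro divide_pos_pos mult_pos_pos add_nonneg_pos) auto
  from near_sum[OF this] obtain \<delta> where "\<delta> > 0" and near: "\<forall>\<^sub>F n in sequentially. \<forall>a b. a \<le> q n \<and> b \<le> q n \<longrightarrow>
          (\<Sum>i\<in>blockA (2^a * n). \<Sum>j\<in>blockA (2^b * n).
             if i \<noteq> j \<and> \<bar>c i - c j\<bar> < \<delta> then - ln \<bar>c i - c j\<bar> else 0)
          < e / (2 * (M\<^sup>2 + 1)) * (real (2^a * n) * real (2^b * n))"
    by blast
  define d where "d = min \<delta> (1/2)"
  have d: "0 < d" "d \<le> 1" "d \<le> \<delta>" using \<open>\<delta> > 0\<close> by (auto simp: d_def)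
  define F where "F x y = f x * (f y * lk_trunc d x y)" for x y
  have F: "continuous_on UNIV (\<lambda>p. F (fst p) (snd p))"
    unfolding F_def using d by (intro continuous_intros continuous_on_compose2[OF f(1)]) auto
  have "ennreal (\<integral>x. \<integral>y. F x y \<partial>P \<partial>P) = (\<integral>\<^sup>+x. \<integral>\<^sup>+y. ennreal (F x y) \<partial>P \<partial>P)"
    by (rule nn_integral_iterated_eq[OF F, symmetric])
       (auto simp: F_def intro!: mult_nonneg_nonneg f lk_trunc_nonneg d)
  also have "\<dots> \<le> weighted_energy P (\<lambda>x. ennreal (f x))"
    unfolding weighted_energy_def nn_integral_cmult[symmetric]
  proof (rule nn_integral_mono)
    fix x
    have "(\<integral>\<^sup>+y. ennreal (F x y) \<partial>P) \<le> (\<integral>\<^sup>+y. ennreal (f x) * (ennreal (f y) * lk x y) \<partial>P)"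
      unfolding F_def ennreal_mult'[OF f(2)]
      by (intro nn_integral_mono mult_left_mono ennreal_lk_trunc_le d) auto
    also have "\<dots> = ennreal (f x) * (\<integral>\<^sup>+y. ennreal (f y) * lk x y \<partial>P)"
      by (rule nn_integral_cmult) measurable
    finally show "(\<integral>\<^sup>+y. ennreal (F x y) \<partial>P) \<le> ennreal (f x) * (\<integral>\<^sup>+y. ennreal (f y) * lk x y \<partial>P)" .
  qed
  also note E(1)
  finally have F_le: "(\<integral>x. \<integral>y. F x y \<partial>P \<partial>P) \<le> E" using E(2) by simp
  obtain N where N: "\<And>n m. n \<ge> N \<Longrightarrow> m \<ge> N \<Longrightarrow> \<bar>(\<Sum>i\<in>blockA n. \<Sum>j\<in>blockA m. F (c i) (c j)) / (real n * real m)
            - (\<integral>x. \<integral>y. F x y \<partial>P \<partial>P)\<bar> < e/2"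
    using double_average[OF F, of "e/2"] \<open>e > 0\<close> by auto
  show ?thesis
    using near eventually_distinct eventually_ge_at_top[of "max 1 N"]
  proof (eventually_elim, intro allI impI)
    fix n a b
    assume near: "\<forall>a b. a \<le> q n \<and> b \<le> q n \<longrightarrow>
          (\<Sum>i\<in>blockA (2^a * n). \<Sum>j\<in>blockA (2^b * n).
             if i \<noteq> j \<and> \<bar>c i - c j\<bar> < \<delta> then - ln \<bar>c i - c j\<bar> else 0)
          < e / (2 * (M\<^sup>2 + 1)) * (real (2^a * n) * real (2^b * n))"
      and distinct: "\<forall>i\<in>blockAq n (q n). \<forall>j\<in>blockAq n (q n). i \<noteq> j \<longrightarrow> c i \<noteq> c j"
      and n: "max 1 N \<le> n" and ab: "a \<le> q n \<and> b \<le> q n"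
    define Na where "Na = 2^a * n"
    define Nb where "Nb = 2^b * n"
    have Nab: "Na \<ge> n" "Nb \<ge> n" "Na \<ge> 1" "Nb \<ge> 1" using n by (auto simp: Na_def Nb_def)
    let ?near = "\<lambda>i j. if i \<noteq> j \<and> \<bar>c i - c j\<bar> < \<delta> then - ln \<bar>c i - c j\<bar> else 0"
    have "(\<Sum>i\<in>blockA Na. \<Sum>j\<in>blockA Nb. if i \<noteq> j then f (c i) * f (c j) * (- ln \<bar>c i - c j\<bar>) else 0)
        \<le> (\<Sum>i\<in>blockA Na. \<Sum>j\<in>blockA Nb. M\<^sup>2 * ?near i j + F (c i) (c j))"
    proof (intro sum_mono)
      fix i j assume i: "i \<in> blockA Na" and j: "j \<in> blockA Nb"
      have cij: "c i \<in> {0<..<1}" "c j \<in> {0<..<1}" using c_blockA Nab i j by auto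
      have F0: "0 \<le> F (c i) (c j)"
        unfolding F_def using cij d by (intro mult_nonneg_nonneg f lk_trunc_nonneg) auto
      show "(if i \<noteq> j then f (c i) * f (c j) * (- ln \<bar>c i - c j\<bar>) else 0) \<le> M\<^sup>2 * ?near i j + F (c i) (c j)"
      proof (cases "i = j")
        case True then show ?thesis using F0 by simp
      next
        case False
        have "i \<in> blockAq n (q n)" "j \<in> blockAq n (q n)"
          using i j ab blockA_subset_blockAq unfolding Na_def Nb_def by blast+
        then have "c i \<noteq> c j" using distinct False by blast
        then have nn: "0 \<le> - ln \<bar>c i - c j\<bar>" using cij by (auto simp: abs_if)
        show ?thesis
        proof (cases "\<bar>c i - c j\<bar> < \<delta>")
          case True
          have "f (c i) * f (c j) \<le> M * M" using f(2)[of "c i"] f(3)[of "c i"] by (intro mult_mono f) auto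
          then have "f (c i) * f (c j) * (- ln \<bar>c i - c j\<bar>) \<le> M\<^sup>2 * (- ln \<bar>c i - c j\<bar>)"
            unfolding power2_eq_square using nn by (rule mult_right_mono)
          then show ?thesis using True False F0 by simp
        next
          case far: False
          then have "F (c i) (c j) = f (c i) * f (c j) * (- ln \<bar>c i - c j\<bar>)"
            using d by (simp add: F_def lk_trunc_def max_def)
          then show ?thesis using False far by simp
        qed
      qed
    qed
    also have "\<dots> = M\<^sup>2 * (\<Sum>i\<in>blockA Na. \<Sum>j\<in>blockA Nb. ?near i j) + (\<Sum>i\<in>blockA Na. \<Sum>j\<in>blockA Nb. F (c i) (c j))"
      unfolding sum.distrib sum_distrib_left ..
    also have "\<dots> \<le> M\<^sup>2 * (e / (2 * (M\<^sup>2 + 1)) * (real Na * real Nb)) + (E + e/2) * (real Na * real Nb)"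
    proof (intro add_mono mult_left_mono)
      show "(\<Sum>i\<in>blockA Na. \<Sum>j\<in>blockA Nb. ?near i j) \<le> e / (2 * (M\<^sup>2 + 1)) * (real Na * real Nb)"
        using near ab unfolding Na_def Nb_def by (blast intro: less_imp_le)
      have "(\<Sum>i\<in>blockA Na. \<Sum>j\<in>blockA Nb. F (c i) (c j)) / (real Na * real Nb) \<le> E + e/2"
        using N[of Na Nb] Nab n F_le by linarith
      then show "(\<Sum>i\<in>blockA Na. \<Sum>j\<in>blockA Nb. F (c i) (c j)) \<le> (E + e/2) * (real Na * real Nb)"
        using Nab by (simp add: pos_divide_le_eq)
    qed auto
    also have "\<dots> = (M\<^sup>2 / (M\<^sup>2 + 1) * (e/2) + E + e/2) * (real Na * real Nb)"
      by (simp add: field_simps)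
    also have "\<dots> \<le> (E + e) * (real Na * real Nb)"
    proof (intro mult_right_mono)
      have "0 < M\<^sup>2 + 1" by (intro add_nonneg_pos) auto
      then have "M\<^sup>2 / (M\<^sup>2 + 1) \<le> 1" by simp
      then have "M\<^sup>2 / (M\<^sup>2 + 1) * (e/2) \<le> 1 * (e/2)" using \<open>e > 0\<close> by (intro mult_right_mono) auto
      then show "M\<^sup>2 / (M\<^sup>2 + 1) * (e/2) + E + e/2 \<le> E + e" by linarith
    qed auto
    finally show "(\<Sum>i\<in>blockA (2^a * n). \<Sum>j\<in>blockA (2^b * n). if i \<noteq> j then f (c i) * f (c j) * (- ln \<bar>c i - c j\<bar>) else 0)
      \<le> (E + e) * (real (2^a * n) * real (2^b * n))"
      unfolding Na_def Nb_def .
  qed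
qed

text \<open>Every block \<open>2^a * n\<close> starts at or after \<open>n\<close>, so all
  \<open>q n + 1\<close> block averages are close to the limit at once, and so is their
  mean.\<close>

lemma block_average_tendsto:
  fixes f :: "real \<Rightarrow> real"
  assumes "continuous_on UNIV f"
  shows "(\<lambda>n. (\<Sum>a\<le>q n. \<Sum>i\<in>blockA (2^a * n). f (c i) / real (2^a * n)) / real (Suc (q n))) \<longlonglongrightarrow> (\<integral>x. f x \<partial>P)"
  unfolding LIMSEQ_iff
proof (intro allI impI)
  fix r :: real assume "r > 0"
  let ?s = "\<integral>x. f x \<partial>P"
  have "(\<lambda>n. (\<Sum>k\<in>blockA n. f (c k)) / real n) \<longlonglongrightarrow> ?s"
    using assms by (intro average_tendsto continuous_on_subset[OF assms] borel_measurable_continuous_onI) auto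
  then obtain N where N: "\<And>n. n \<ge> N \<Longrightarrow> norm ((\<Sum>k\<in>blockA n. f (c k)) / real n - ?s) < r/2"
    using \<open>r > 0\<close> unfolding LIMSEQ_iff by (metis half_gt_zero)
  show "\<exists>N. \<forall>n\<ge>N. norm ((\<Sum>a\<le>q n. \<Sum>i\<in>blockA (2^a * n). f (c i) / real (2^a * n)) / real (Suc (q n)) - ?s) < r"
  proof (intro exI allI impI)
    fix n assume n: "N \<le> n"
    let ?S = "\<lambda>a. \<Sum>i\<in>blockA (2^a * n). f (c i) / real (2^a * n)"
    have "(\<Sum>a\<le>q n. ?S a) / real (Suc (q n)) - ?s = (\<Sum>a\<le>q n. ?S a - ?s) / real (Suc (q n))"
      by (simp add: sum_subtractf diff_divide_distrib del: of_nat_Suc)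
    moreover have "norm (\<Sum>a\<le>q n. ?S a - ?s) \<le> real (card {..q n}) * (r/2)"
    proof (rule sum_norm_bound)
      fix a
      have "N \<le> 2^a * n" using n by (metis le_trans mult_le_mono1 mult_1 one_le_numeral one_le_power)
      from N[OF this] show "norm (?S a - ?s) \<le> r/2" by (simp add: sum_divide_distrib)
    qed
    ultimately have "norm ((\<Sum>a\<le>q n. ?S a) / real (Suc (q n)) - ?s) \<le> r/2"
      by (simp add: field_simps del: of_nat_Suc)
    then show "norm ((\<Sum>a\<le>q n. ?S a) / real (Suc (q n)) - ?s) < r" using \<open>r > 0\<close> by simp
  qed
qed

text \<open>The term \<open>lam * real i + 3\<close> bounds the self-energy of a uniform
  distribution of length \<open>exp (- lam * real i) / 2\<close>. In a block of size N it is of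
  order N and occurs N times, so division by N^2 leaves a constant. Disjoint blocks share no
  index.\<close>

lemma diagonal_sum:
  assumes "n \<ge> 1" "0 \<le> C"
  shows "(\<Sum>i\<in>blockA (2^a * n). \<Sum>j\<in>blockA (2^b * n). if i = j then C * (lam * real i + 3) else 0)
    \<le> (if a = b then C * (2 * lam + 3) else 0) * (real (2^a * n) * real (2^b * n))"
proof (cases "a = b")
  case False
  then have "(\<Sum>i\<in>blockA (2^a * n). \<Sum>j\<in>blockA (2^b * n). if i = j then C * (lam * real i + 3) else 0) = 0"
    by (intro sum.neutral ballI) (auto dest: blockA_disjoint)
  then show ?thesis using False by simp
next
  case True
  define N where "N = 2^b * n"
  have "N \<ge> 1" using assms(1) by (simp add: N_def Suc_le_eq)
  then have N: "real N \<ge> 1" by simp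
  have "(\<Sum>i\<in>blockA N. \<Sum>j\<in>blockA N. if i = j then C * (lam * real i + 3) else 0) = (\<Sum>i\<in>blockA N. C * (lam * real i + 3))"
    by (intro sum.cong refl) simp
  also have "\<dots> \<le> (\<Sum>i\<in>blockA N. C * ((2 * lam + 3) * real N))"
  proof (intro sum_mono mult_left_mono assms)
    fix i assume "i \<in> blockA N"
    then have "lam * real i \<le> lam * (2 * real N)" using lam_pos by (intro mult_left_mono) (auto simp: blockA_def)
    moreover have "(2 * lam + 3) * real N = lam * (2 * real N) + 3 * real N" by (simp add: algebra_simps)
    ultimately show "lam * real i + 3 \<le> (2 * lam + 3) * real N" using N by linarith
  qed
  also have "\<dots> = C * (2 * lam + 3) * (real N * real N)" by simp
  finally show ?thesis using True by (simp add: N_def)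
qed


text \<open>\<open>D i j\<close> will bound the mutual energy of the intervals at \<open>c i\<close>
  and \<open>c j\<close>. Self-energies enter only through pairs with \<open>a = b\<close>, a
  fraction \<open>1 / Suc (q n)\<close> of all pairs of blocks, which makes the last term vanish in
  the limit.\<close>

lemma discretized_energy_bound:
  fixes f :: "real \<Rightarrow> real"
  assumes f: "continuous_on UNIV f" "\<And>x. 0 \<le> f x" "\<And>x. f x \<le> M"
    and E: "weighted_energy P (\<lambda>x. ennreal (f x)) \<le> ennreal E" "0 \<le> E" and "e > 0" and "\<eta> > 0"
  defines "D \<equiv> \<lambda>i j. if i = j then lam * real i + 3 else - ln \<bar>c i - c j\<bar> + \<eta>"
  shows "\<forall>\<^sub>F n in sequentially.
     (\<Sum>a\<le>q n. \<Sum>b\<le>q n. (\<Sum>i\<in>blockA (2^a * n). \<Sum>j\<in>blockA (2^b * n). f (c i) * f (c j) * D i j) / (real (2^a * n) * real (2^b * n)))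
      / (real (Suc (q n)))\<^sup>2 \<le> E + e + M\<^sup>2 * \<eta> + M\<^sup>2 * (2 * lam + 3) / real (Suc (q n))"
  using off_diagonal_sum[OF f E \<open>e > 0\<close>] eventually_ge_at_top[of 1]
proof eventually_elim
  case (elim n)
  define Q where "Q = real (Suc (q n))"
  have Q: "Q > 0" by (simp add: Q_def)
  have M: "f x * f y \<le> M\<^sup>2" for x y
    unfolding power2_eq_square using f(2)[of x] f(3)[of x] by (intro mult_mono f) auto
  have inner: "(\<Sum>i\<in>blockA (2^a * n). \<Sum>j\<in>blockA (2^b * n). f (c i) * f (c j) * D i j) / (real (2^a * n) * real (2^b * n))
      \<le> E + e + M\<^sup>2 * \<eta> + (if a = b then M\<^sup>2 * (2 * lam + 3) else 0)" if "a \<le> q n" "b \<le> q n" for a b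
  proof -
    let ?N = "real (2^a * n) * real (2^b * n)"
    have N: "?N > 0" using elim(2) by (simp add: Suc_le_eq)
    have "(\<Sum>i\<in>blockA (2^a * n). \<Sum>j\<in>blockA (2^b * n). f (c i) * f (c j) * D i j)
       \<le> (\<Sum>i\<in>blockA (2^a * n). \<Sum>j\<in>blockA (2^b * n).
            (if i \<noteq> j then f (c i) * f (c j) * (- ln \<bar>c i - c j\<bar>) else 0) + M\<^sup>2 * \<eta>
            + (if i = j then M\<^sup>2 * (lam * real i + 3) else 0))"
    proof (intro sum_mono)
      fix i j
      have "f (c i) * f (c j) * \<eta> \<le> M\<^sup>2 * \<eta>" using M \<open>\<eta> > 0\<close> by (intro mult_right_mono) auto
      moreover have "f (c i) * f (c j) * (lam * real i + 3) \<le> M\<^sup>2 * (lam * real i + 3)"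
        using M lam_pos by (intro mult_right_mono add_nonneg_nonneg) auto
      moreover have "0 \<le> M\<^sup>2 * \<eta>" using \<open>\<eta> > 0\<close> by simp
      ultimately show "f (c i) * f (c j) * D i j \<le> (if i \<noteq> j then f (c i) * f (c j) * (- ln \<bar>c i - c j\<bar>) else 0) + M\<^sup>2 * \<eta>
            + (if i = j then M\<^sup>2 * (lam * real i + 3) else 0)"
        unfolding D_def by (auto simp: distrib_left right_diff_distrib)
    qed
    also have "\<dots> = (\<Sum>i\<in>blockA (2^a * n). \<Sum>j\<in>blockA (2^b * n). if i \<noteq> j then f (c i) * f (c j) * (- ln \<bar>c i - c j\<bar>) else 0)
        + M\<^sup>2 * \<eta> * ?N + (\<Sum>i\<in>blockA (2^a * n). \<Sum>j\<in>blockA (2^b * n). if i = j then M\<^sup>2 * (lam * real i + 3) else 0)"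
      unfolding sum.distrib by simp
    also have "\<dots> \<le> (E + e) * ?N + M\<^sup>2 * \<eta> * ?N + (if a = b then M\<^sup>2 * (2 * lam + 3) else 0) * ?N"
      using elim(1)[rule_format, of a b] that by (intro add_mono order_refl diagonal_sum elim(2)) auto
    also have "\<dots> = (E + e + M\<^sup>2 * \<eta> + (if a = b then M\<^sup>2 * (2 * lam + 3) else 0)) * ?N"
      by (simp only: distrib_right)
    finally show ?thesis unfolding pos_divide_le_eq[OF N] .
  qed
  have "(\<Sum>a\<le>q n. \<Sum>b\<le>q n. (\<Sum>i\<in>blockA (2^a * n). \<Sum>j\<in>blockA (2^b * n). f (c i) * f (c j) * D i j) / (real (2^a * n) * real (2^b * n)))
     \<le> (\<Sum>a\<le>q n. \<Sum>b\<le>q n. E + e + M\<^sup>2 * \<eta> + (if a = b then M\<^sup>2 * (2 * lam + 3) else 0))"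
    by (intro sum_mono inner) auto
  also have "\<dots> = Q * (Q * (E + e + M\<^sup>2 * \<eta>)) + Q * (M\<^sup>2 * (2 * lam + 3))"
    unfolding Q_def by (simp add: sum.distrib algebra_simps)
  also have "\<dots> = (E + e + M\<^sup>2 * \<eta> + M\<^sup>2 * (2 * lam + 3) / Q) * Q\<^sup>2"
    using Q by (simp add: field_simps power2_eq_square)
  finally show ?case
    using Q by (simp only: Q_def[symmetric] pos_divide_le_eq[OF zero_less_power[OF Q]])
qed

text \<open>Moving the two points off their centers changes the distance by at most a quarter of the
  sum of lengths. By (A3) with tolerance \<open>1 - exp (- \<eta>)\<close> a fraction at least
  \<open>exp (- \<eta>)\<close> of the distance survives, so the kernel rises by at most
  \<open>\<eta>\<close>.\<close>

lemma mutual_energy_intervals_le: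
  assumes "\<eta> > 0" "k \<ge> 1" "k' \<ge> 1" "c k \<noteq> c k'"
    and sep: "exp (- lam * real k) + exp (- lam * real k') < 2 * (1 - exp (- \<eta>)) * \<bar>c k - c k'\<bar>"
    and y: "\<bar>y - c k\<bar> \<le> exp (- lam * real k) / 4" "\<bar>y' - c k'\<bar> \<le> exp (- lam * real k') / 4"
  shows "lk y y' \<le> ennreal (- ln \<bar>c k - c k'\<bar> + \<eta>)"
proof -
  let ?d = "\<bar>c k - c k'\<bar>"
  have d: "0 < ?d" "?d < 1" using assms c_range[of k] c_range[of k'] by auto
  have "?d * exp (- \<eta>) \<le> \<bar>y - y'\<bar>"
  proof -
    have quarter: "0 \<le> X \<Longrightarrow> S < 2 * X \<Longrightarrow> S / 4 \<le> X" for S X :: real by linarith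
    have "(1 - exp (- \<eta>)) * ?d \<ge> 0" using \<open>\<eta> > 0\<close> by simp
    then have "(exp (- lam * real k) + exp (- lam * real k')) / 4 \<le> (1 - exp (- \<eta>)) * ?d"
      using sep unfolding mult.assoc by (rule quarter)
    moreover have "(1 - exp (- \<eta>)) * ?d = ?d - ?d * exp (- \<eta>)" by (simp add: algebra_simps)
    moreover have "X \<le> Y \<Longrightarrow> Y = d - Z \<Longrightarrow> Z \<le> d - X" for X Y Z d :: real by linarith
    ultimately have "?d * exp (- \<eta>) \<le> ?d - (exp (- lam * real k) + exp (- lam * real k')) / 4"
      by blast
    also have "\<dots> \<le> \<bar>y - y'\<bar>"
    proof -
      have "?d \<le> \<bar>y - c k\<bar> + \<bar>y - y'\<bar> + \<bar>y' - c k'\<bar>" by arith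
      then show ?thesis using y unfolding add_divide_distrib by linarith
    qed
    finally show ?thesis .
  qed
  then have "lk y y' \<le> ennreal (max 0 (- ln (?d * exp (- \<eta>))))"
    using d by (intro lk_le) auto
  also have "max 0 (- ln (?d * exp (- \<eta>))) = - ln ?d + \<eta>"
  proof -
    have "ln ?d < 0" using d by simp
    moreover have "ln (?d * exp (- \<eta>)) = ln ?d - \<eta>" using d by (simp add: ln_mult)
    ultimately show ?thesis using \<open>\<eta> > 0\<close> by linarith
  qed
  finally show ?thesis .
qed


text \<open>One step of the iteration: the continuous weight for \<open>\<mu>\<close> is sampled at
  the centers of \<open>q n + 1\<close> blocks, and each sample is spread uniformly over an interval
  around its center. The index \<open>m\<close> pushes all chosen centers past it.\<close>

lemma refine_measure:
  fixes b :: real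
  assumes "prob_space \<mu>" "sets \<mu> = sets borel" "absolutely_continuous lborel \<mu>"
    and U: "open U" "U \<subseteq> {0<..<1}" "AE x in \<mu>. x \<in> U" and "energy \<mu> < ennreal b"
  shows "\<exists>\<mu>' U' K. prob_space \<mu>' \<and> sets \<mu>' = sets borel \<and> absolutely_continuous lborel \<mu>' \<and> open U' \<and>
    (AE x in \<mu>'. x \<in> U') \<and> energy \<mu>' < ennreal b \<and> compact K \<and> U' \<subseteq> K \<and> K \<subseteq> U \<and>
    K \<subseteq> (\<Union>k\<in>{m..}. {c k - exp (- lam * real k) / 2<..<c k + exp (- lam * real k) / 2})"
proof -
  obtain f M \<rho> where f: "continuous_on UNIV f" "\<And>x. 0 \<le> f x" "\<And>x. f x \<le> M" and "\<rho> > 0"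
    and f_supp: "\<And>x. f x \<noteq> 0 \<Longrightarrow> ball x \<rho> \<subseteq> U"
    and f_energy: "weighted_energy P (\<lambda>x. ennreal (f x)) < ennreal (b * (\<integral>x. f x \<partial>P)\<^sup>2)"
    using continuous_weight[OF assms] by metis
  define s where "s = (\<integral>x. f x \<partial>P)"
  obtain E where E: "weighted_energy P (\<lambda>x. ennreal (f x)) = ennreal E" "0 \<le> E"
    using f_energy by (cases "weighted_energy P (\<lambda>x. ennreal (f x))") auto
  have E_less: "E < b * s\<^sup>2" using f_energy E by (simp add: s_def ennreal_less_iff)
  have s: "s > 0"
  proof -
    have "s \<ge> 0" unfolding s_def by (intro Bochner_Integration.integral_nonneg f)
    moreover have "s \<noteq> 0" using E_less E by auto
    ultimately show ?thesis by simp
  qed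
  \<comment> \<open>Half of the gap, \<open>4 * g\<close>, is spent: one \<open>g\<close> each for
    the off-diagonal error, for \<open>M\<^sup>2 * \<eta>\<close> and for the self-energies, and one
    to spare. The other half absorbs the convergence of the mass \<open>W n\<close>.\<close>
  define g where "g = (b * s\<^sup>2 - E) / 8"
  have g: "g > 0" using E_less by (simp add: g_def)
  define \<eta> where "\<eta> = g / (M\<^sup>2 + 1)"
  have M1: "M\<^sup>2 + 1 > 0" by (intro add_nonneg_pos) auto
  have \<eta>: "\<eta> > 0" "M\<^sup>2 * \<eta> \<le> g"
  proof -
    show "\<eta> > 0" using g M1 by (simp add: \<eta>_def)
    have "M\<^sup>2 / (M\<^sup>2 + 1) * g \<le> 1 * g" using g M1 by (intro mult_right_mono) auto
    then show "M\<^sup>2 * \<eta> \<le> g" by (simp add: \<eta>_def)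
  qed
  define W where "W n = (\<Sum>a\<le>q n. \<Sum>i\<in>blockA (2^a * n). f (c i) / real (2^a * n)) / real (Suc (q n))" for n
  have W_lim: "W \<longlonglongrightarrow> s" unfolding W_def s_def by (rule block_average_tendsto[OF f(1)])
  have ev1: "\<forall>\<^sub>F n in sequentially. W n > 0" by (rule order_tendstoD(1)[OF W_lim s])
  have "(\<lambda>n. b * (W n)\<^sup>2) \<longlonglongrightarrow> b * s\<^sup>2" by (intro tendsto_intros W_lim)
  then have ev2: "\<forall>\<^sub>F n in sequentially. E + 4 * g < b * (W n)\<^sup>2"
    by (rule order_tendstoD) (use E_less in \<open>simp add: g_def field_simps\<close>)
  have "(\<lambda>n. M\<^sup>2 * (2 * lam + 3) / real (Suc (q n))) \<longlonglongrightarrow> 0"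
    using q_lim by (intro real_tendsto_divide_at_top[OF tendsto_const] filterlim_compose[OF filterlim_real_sequentially]
      filterlim_compose[OF filterlim_Suc])
  then have ev3: "\<forall>\<^sub>F n in sequentially. M\<^sup>2 * (2 * lam + 3) / real (Suc (q n)) < g"
    by (rule order_tendstoD) (use g in simp)
  have "(\<lambda>n. exp (- (lam * real n))) \<longlonglongrightarrow> 0"
    by (intro filterlim_compose[OF exp_at_bot] filterlim_compose[OF filterlim_uminus_at_bot_at_top]
      filterlim_tendsto_pos_mult_at_top[OF tendsto_const lam_pos] filterlim_real_sequentially)
  then have ev4: "\<forall>\<^sub>F n in sequentially. exp (- (lam * real n)) < \<rho>"
    by (rule order_tendstoD) (use \<open>\<rho> > 0\<close> in simp)
  define D where "D i j = (if i = j then lam * real i + 3 else - ln \<bar>c i - c j\<bar> + \<eta>)" for i j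
  have ev5: "\<forall>\<^sub>F n in sequentially.
     (\<Sum>a\<le>q n. \<Sum>b\<le>q n. (\<Sum>i\<in>blockA (2^a * n). \<Sum>j\<in>blockA (2^b * n). f (c i) * f (c j) * D i j) / (real (2^a * n) * real (2^b * n)))
      / (real (Suc (q n)))\<^sup>2 \<le> E + g + M\<^sup>2 * \<eta> + M\<^sup>2 * (2 * lam + 3) / real (Suc (q n))"
    unfolding D_def using E by (intro discretized_energy_bound f g \<eta>) auto
  have "1 - exp (- \<eta>) > 0" using \<eta> by simp
  from eventually_happens'[OF sequentially_bot eventually_conj[OF separated[OF this]
      eventually_conj[OF ev1 eventually_conj[OF ev2 eventually_conj[OF ev3 eventually_conj[OF ev4
      eventually_conj[OF ev5 eventually_conj[OF eventually_distinct eventually_ge_at_top[of "max 1 m"]]]]]]]]]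
  obtain n where sep: "\<forall>i\<in>blockAq n (q n). \<forall>j\<in>blockAq n (q n). i \<noteq> j \<longrightarrow>
                 exp (- lam * real i) + exp (- lam * real j) < 2 * (1 - exp (- \<eta>)) * \<bar>c i - c j\<bar>"
    and W_pos: "W n > 0" and W_large: "E + 4 * g < b * (W n)\<^sup>2"
    and Q_large: "M\<^sup>2 * (2 * lam + 3) / real (Suc (q n)) < g" and exp_small: "exp (- (lam * real n)) < \<rho>"
    and sum_le: "(\<Sum>a\<le>q n. \<Sum>b\<le>q n. (\<Sum>i\<in>blockA (2^a * n). \<Sum>j\<in>blockA (2^b * n). f (c i) * f (c j) * D i j) / (real (2^a * n) * real (2^b * n)))
      / (real (Suc (q n)))\<^sup>2 \<le> E + g + M\<^sup>2 * \<eta> + M\<^sup>2 * (2 * lam + 3) / real (Suc (q n))"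
    and distinct: "\<forall>i\<in>blockAq n (q n). \<forall>j\<in>blockAq n (q n). i \<noteq> j \<longrightarrow> c i \<noteq> c j"
    and n: "max 1 m \<le> n" by blast
  define Q where "Q = real (Suc (q n))"
  have Q: "Q > 0" by (simp add: Q_def)
  \<comment> \<open>Indices carry their block number, since the weight depends on the size of the
    block.\<close>
  define F where "F = (SIGMA a:{..q n}. blockA (2^a * n))"
  have finF: "finite F" unfolding F_def by (intro finite_SigmaI) auto
  have F_ge: "i \<ge> n" "i \<ge> 1" "i \<in> blockAq n (q n)" "c i \<in> {0<..<1}" if "(a, i) \<in> F" for a i
  proof -
    have i: "i \<in> blockA (2^a * n)" "a \<le> q n" using that by (auto simp: F_def)
    have "n \<le> 2^a * n" by simp
    then show "i \<ge> n" using i(1) unfolding blockA_def by (meson atLeastLessThan_iff le_trans)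
    then show "i \<ge> 1" using n by simp
    then show "c i \<in> {0<..<1}" by (rule c_range)
    show "i \<in> blockAq n (q n)" using i blockA_subset_blockAq by blast
  qed
  \<comment> \<open>Within a block the weights follow \<open>f\<close>; dividing by block size and
    by \<open>Q\<close> gives all blocks comparable mass, and \<open>W n\<close> normalizes the
    total to 1.\<close>
  define w where "w = (\<lambda>(a, i). f (c i) / real (2^a * n) / (Q * W n))"
  have w: "0 \<le> w p" for p
    unfolding w_def case_prod_beta using Q W_pos f by (intro divide_nonneg_nonneg mult_nonneg_nonneg) auto
  have w_sum: "(\<Sum>p\<in>F. w p) = 1"
  proof -
    have "(\<Sum>p\<in>F. w p) = (\<Sum>a\<le>q n. \<Sum>i\<in>blockA (2^a * n). f (c i) / real (2^a * n)) / (Q * W n)"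
      unfolding F_def w_def sum_divide_distrib by (subst sum.Sigma) auto
    also have "\<dots> = W n / W n" by (simp add: W_def Q_def)
    finally show ?thesis using W_pos by simp
  qed
  \<comment> \<open>Half the length of the interval at \<open>c i\<close>: the closed shorter
    interval lies inside the open one, so finite unions are compact and contained in the tail
    union.\<close>
  define l where "l i = exp (- lam * real i) / 2" for i :: nat
  have l: "0 < l i" "l i \<le> 1" for i
  proof -
    have "exp (- lam * real i) \<le> 1" using lam_pos by simp
    then show "0 < l i" "l i \<le> 1" using exp_gt_zero[of "- lam * real i"] unfolding l_def by linarith+
  qed
  define v where "v p y = ennreal (1 / l (snd p)) * indicator {c (snd p) - l (snd p) / 2..c (snd p) - l (snd p) / 2 + l (snd p)} y" for p :: "nat \<times> nat" and y
  define M0 where "M0 = point_measure F (\<lambda>p. ennreal (w p))"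
  have sets_M0: "sets M0 = sets (count_space F)" by (simp add: M0_def sets_point_measure)
  have v_meas: "case_prod v \<in> borel_measurable (M0 \<Otimes>\<^sub>M lborel)"
  proof -
    have "case_prod v \<in> borel_measurable (count_space F \<Otimes>\<^sub>M lborel)"
    proof (rule measurable_pair_measure_countable1)
      show "(\<lambda>y. case_prod v (p, y)) \<in> borel_measurable lborel" for p
        unfolding v_def by simp
    qed (use finF in \<open>auto intro: countable_finite\<close>)
    then show ?thesis
      by (subst measurable_cong_sets[OF sets_pair_measure_cong[OF sets_M0 refl] refl])
  qed
  have prob_M0: "prob_space M0"
  proof
    have "emeasure M0 (space M0) = (\<Sum>p\<in>F. ennreal (w p))"
      unfolding M0_def by (simp add: space_point_measure emeasure_point_measure_finite finF)
    also have "\<dots> = 1" using w w_sum by (simp add: sum_ennreal)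
    finally show "emeasure M0 (space M0) = 1" .
  qed
  interpret M0: prob_space M0 by fact
  let ?\<mu>' = "density lborel (\<lambda>y. \<integral>\<^sup>+p. v p y \<partial>M0)"
  define G where "G = {p \<in> F. f (c (snd p)) \<noteq> 0}"
  have finG: "finite G" using finF by (simp add: G_def)
  define U' where "U' = (\<Union>p\<in>G. {c (snd p) - l (snd p) / 2<..<c (snd p) + l (snd p) / 2})"
  define K where "K = (\<Union>p\<in>G. {c (snd p) - l (snd p) / 2..c (snd p) + l (snd p) / 2})"
  have K_E: "\<exists>a i. (a, i) \<in> F \<and> f (c i) \<noteq> 0 \<and> \<bar>x - c i\<bar> \<le> l i / 2" if x: "x \<in> K" for x
  proof -
    obtain a i where "(a, i) \<in> F" "f (c i) \<noteq> 0" "x \<in> {c i - l i / 2..c i + l i / 2}"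
      using x unfolding K_def G_def by auto
    moreover from this(3) have "\<bar>x - c i\<bar> \<le> l i / 2" unfolding atLeastAtMost_iff by linarith
    ultimately show ?thesis by blast
  qed
  have "prob_space ?\<mu>'"
  proof (rule prob_space_density_mixture[OF prob_M0 v_meas], rule AE_I2)
    show "(\<integral>\<^sup>+y. v p y \<partial>lborel) = 1" for p
      unfolding v_def using nn_integral_uniform_const[OF l(1), where C=1] by (simp only: mult_1_right)
  qed
  moreover have ac: "absolutely_continuous lborel ?\<mu>'"
    using M0.borel_measurable_nn_integral[of "\<lambda>y p. v p y" lborel] v_meas
    by (intro absolutely_continuousI_density) (simp add: measurable_pair_swap_iff[of _ M0] case_prod_beta')
  moreover have "open U'" unfolding U'_def by auto
  moreover have "compact K" unfolding K_def by (intro compact_UN finG) auto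
  moreover have "U' \<subseteq> K" unfolding U'_def K_def by fastforce
  moreover have "K \<subseteq> U"
  proof
    fix x assume "x \<in> K"
    then obtain a i where p: "(a, i) \<in> F" "f (c i) \<noteq> 0" "\<bar>x - c i\<bar> \<le> l i / 2"
      using K_E by blast
    have "l i \<le> exp (- (lam * real n))"
    proof -
      have "exp (- lam * real i) \<le> exp (- (lam * real n))" using F_ge(1)[OF p(1)] lam_pos by simp
      then show ?thesis using exp_gt_zero[of "- lam * real i"] unfolding l_def by linarith
    qed
    then have "dist (c i) x < \<rho>" using p(3) exp_small l(1)[of i] by (simp add: dist_real_def abs_minus_commute)
    then show "x \<in> U" using f_supp[OF p(2)] by auto
  qed
  moreover have "K \<subseteq> (\<Union>k\<in>{m..}. {c k - exp (- lam * real k) / 2<..<c k + exp (- lam * real k) / 2})"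
  proof
    fix x assume "x \<in> K"
    then obtain a i where p: "(a, i) \<in> F" "\<bar>x - c i\<bar> \<le> l i / 2"
      using K_E by blast
    have "\<bar>x - c i\<bar> < exp (- lam * real i) / 2" using p(2) l(1)[of i] unfolding l_def by linarith
    then have "x \<in> {c i - exp (- lam * real i) / 2<..<c i + exp (- lam * real i) / 2}"
      unfolding greaterThanLessThan_iff by linarith
    moreover have "i \<ge> m" using F_ge(1)[OF p(1)] n by simp
    ultimately show "x \<in> (\<Union>k\<in>{m..}. {c k - exp (- lam * real k) / 2<..<c k + exp (- lam * real k) / 2})"
      by blast
  qed
  moreover have "AE x in ?\<mu>'. x \<in> U'"
  proof -
    have "AE y in ?\<mu>'. y \<in> K"
    proof (rule AE_density_mixture[OF M0.sigma_finite_measure_axioms v_meas])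
      have "v p y = 0" if "p \<in> F" "w p > 0" "y \<notin> K" for p y
      proof -
        have "p \<in> G" using that unfolding G_def w_def by (auto simp: case_prod_beta)
        then have "y \<notin> {c (snd p) - l (snd p) / 2..c (snd p) + l (snd p) / 2}"
          using that(3) unfolding K_def by blast
        then show ?thesis unfolding v_def by (auto simp: indicator_def)
      qed
      then show "AE p in M0. \<forall>y. y \<notin> K \<longrightarrow> v p y = 0"
        unfolding M0_def by (subst AE_point_measure) auto
    qed
    \<comment> \<open>The finitely many endpoints are null, so the measure is carried by the open
      \<open>U'\<close> as well as by \<open>K\<close>; the next refinement works inside
      \<open>U'\<close>.\<close>
    moreover have "AE y in ?\<mu>'. y \<notin> (\<Union>p\<in>G. {c (snd p) - l (snd p) / 2, c (snd p) + l (snd p) / 2})"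
      using finG by (intro absolutely_continuous_AE[OF _ ac] AE_not_in finite_imp_null_set_lborel) auto
    ultimately show ?thesis
      by eventually_elim (auto simp: K_def U'_def order_le_less)
  qed
  moreover have "energy ?\<mu>' < ennreal b"
  proof -
    let ?e = "\<lambda>p p'. \<integral>\<^sup>+y. v p y * (\<integral>\<^sup>+y'. v p' y' * lk y y' \<partial>lborel) \<partial>lborel"
    have D_nn: "0 \<le> D i j" if "(a, i) \<in> F" "(a', j) \<in> F" for a i a' j
    proof (cases "i = j")
      case True then show ?thesis using lam_pos by (simp add: D_def)
    next
      case False
      have "c i \<noteq> c j" using distinct F_ge(3)[OF that(1)] F_ge(3)[OF that(2)] False by blast
      then have "0 \<le> - ln \<bar>c i - c j\<bar>" using F_ge(4)[OF that(1)] F_ge(4)[OF that(2)] by (auto simp: abs_if)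
      then show ?thesis using False \<eta> by (simp add: D_def)
    qed
    have e_le: "?e (a, i) (a', j) \<le> ennreal (D i j)" if p: "(a, i) \<in> F" "(a', j) \<in> F" for a i a' j
    proof (cases "i = j")
      case True
      have "?e (a, i) (a', j) \<le> ennreal (2 - ln (l j))"
        unfolding v_def snd_conv by (rule mutual_uniform_energy_le_ln) (use l in auto)
      also have "ln (l j) = - (lam * real j) - ln 2" unfolding l_def by (simp add: ln_div)
      \<comment> \<open>The halved length contributes \<open>ln 2\<close>, at most 1, which explains
        the 3 in \<open>D\<close>.\<close>
      also have "ennreal (2 - (- (lam * real j) - ln 2)) \<le> ennreal (D i j)"
        using True ln_le_minus_one[of "2::real"] by (intro ennreal_leI) (simp add: D_def)
      finally show ?thesis .
    next
      case False
      note ij = F_ge(2,3)[OF p(1)] F_ge(2,3)[OF p(2)]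
      show ?thesis
        unfolding v_def snd_conv
      proof (rule mutual_uniform_energy_le)
        show "0 \<le> D i j" by (rule D_nn) fact+
        fix y y' assume y: "y \<in> {c i - l i / 2..c i - l i / 2 + l i}" "y' \<in> {c j - l j / 2..c j - l j / 2 + l j}"
        have "\<bar>y - c i\<bar> \<le> exp (- lam * real i) / 4" "\<bar>y' - c j\<bar> \<le> exp (- lam * real j) / 4"
          using y unfolding l_def atLeastAtMost_iff by linarith+
        then have "lk y y' \<le> ennreal (- ln \<bar>c i - c j\<bar> + \<eta>)"
          using sep distinct ij False \<eta>(1) by (intro mutual_energy_intervals_le) auto
        then show "lk y y' \<le> ennreal (D i j)" using False by (simp add: D_def)
      qed (use l in auto)
    qed
    have "energy ?\<mu>' = (\<Sum>p\<in>F. ennreal (w p) * (\<Sum>p'\<in>F. ennreal (w p') * ?e p p'))"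
      unfolding energy_density_mixture[OF M0.sigma_finite_measure_axioms v_meas]
      unfolding M0_def nn_integral_point_measure_finite[OF finF] ..
    also have "\<dots> \<le> (\<Sum>p\<in>F. ennreal (w p) * (\<Sum>p'\<in>F. ennreal (w p') * ennreal (D (snd p) (snd p'))))"
    proof (intro sum_mono mult_left_mono)
      fix p p' assume "p \<in> F" "p' \<in> F"
      then show "?e p p' \<le> ennreal (D (snd p) (snd p'))"
        using e_le[of "fst p" "snd p" "fst p'" "snd p'"] by simp
    qed auto
    also have "\<dots> = (\<Sum>p\<in>F. \<Sum>p'\<in>F. ennreal (w p * w p' * D (snd p) (snd p')))"
      unfolding sum_distrib_left
    proof (intro sum.cong refl)
      fix p p' assume "p \<in> F" "p' \<in> F"
      then have "0 \<le> D (snd p) (snd p')" using D_nn[of "fst p" "snd p" "fst p'" "snd p'"] by simp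
      then show "ennreal (w p) * (ennreal (w p') * ennreal (D (snd p) (snd p'))) = ennreal (w p * w p' * D (snd p) (snd p'))"
        using w by (simp add: ennreal_mult mult.assoc)
    qed
    also have "\<dots> = ennreal (\<Sum>p\<in>F. \<Sum>p'\<in>F. w p * w p' * D (snd p) (snd p'))"
    proof -
      have "0 \<le> w p * w p' * D (snd p) (snd p')" if "p \<in> F" "p' \<in> F" for p p'
        using D_nn[of "fst p" "snd p" "fst p'" "snd p'"] that by (intro mult_nonneg_nonneg w) auto
      then show ?thesis by (simp add: sum_ennreal sum_nonneg)
    qed
    also have "\<dots> < ennreal b"
    proof -
      have sum_F: "(\<Sum>p\<in>F. h p) = (\<Sum>a\<le>q n. \<Sum>i\<in>blockA (2^a * n). h (a, i))" for h :: "nat \<times> nat \<Rightarrow> real"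
        unfolding F_def by (simp add: sum.Sigma)
      have "(\<Sum>p\<in>F. \<Sum>p'\<in>F. w p * w p' * D (snd p) (snd p'))
         = (\<Sum>a\<le>q n. \<Sum>i\<in>blockA (2^a * n). \<Sum>b\<le>q n. \<Sum>j\<in>blockA (2^b * n). w (a, i) * w (b, j) * D i j)"
        unfolding sum_F snd_conv ..
      also have "\<dots> = (\<Sum>a\<le>q n. \<Sum>b\<le>q n. \<Sum>i\<in>blockA (2^a * n). \<Sum>j\<in>blockA (2^b * n). w (a, i) * w (b, j) * D i j)"
        by (rule sum.cong[OF refl], rule sum.swap)
      also have "\<dots> = (\<Sum>a\<le>q n. \<Sum>b\<le>q n. (\<Sum>i\<in>blockA (2^a * n). \<Sum>j\<in>blockA (2^b * n). f (c i) * f (c j) * D i j) / (real (2^a * n) * real (2^b * n)))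
           / (Q\<^sup>2 * (W n)\<^sup>2)"
        unfolding sum_divide_distrib
        by (intro sum.cong refl) (simp add: w_def power2_eq_square field_simps)
      also have "\<dots> \<le> (E + g + M\<^sup>2 * \<eta> + M\<^sup>2 * (2 * lam + 3) / Q) / (W n)\<^sup>2"
        using divide_right_mono[OF sum_le, of "(W n)\<^sup>2"] unfolding Q_def[symmetric] by (simp add: divide_divide_eq_left)
      also have "\<dots> \<le> (E + 4 * g) / (W n)\<^sup>2"
        using \<eta>(2) Q_large g unfolding Q_def[symmetric] by (intro divide_right_mono) auto
      also have "\<dots> < b" using W_large W_pos by (simp add: pos_divide_less_eq)
      finally have *: "(\<Sum>p\<in>F. \<Sum>p'\<in>F. w p * w p' * D (snd p) (snd p')) < b" .
      have "0 < b" using W_large W_pos E g by (smt (verit) zero_less_mult_pos2 zero_less_power)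
      with * show ?thesis by (cases "(\<Sum>p\<in>F. \<Sum>p'\<in>F. w p * w p' * D (snd p) (snd p')) \<ge> 0") (auto simp: ennreal_less_iff ennreal_neg)
    qed
    finally show ?thesis .
  qed
  ultimately show ?thesis
    by (intro exI[of _ ?\<mu>'] exI[of _ U'] exI[of _ K]) simp
qed

end

section \<open>Weak limits and transfer to the complex plane\<close>

text \<open>Lower semicontinuity, because \<open>lk\<close> is a supremum of continuous
  truncations.\<close>

lemma lk_le_liminf:
  assumes "X \<longlonglongrightarrow> x" "Y \<longlonglongrightarrow> y"
  shows "lk x y \<le> liminf (\<lambda>n. lk (X n) (Y n))"
  unfolding lk_eq_SUP_trunc[of x y]
proof (rule SUP_least)
  fix m
  let ?d = "1 / real (Suc m)"
  have "0 < max \<bar>x - y\<bar> ?d" by (rule less_le_trans[OF _ max.cobounded2]) simp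
  then have "(\<lambda>n. lk_trunc ?d (X n) (Y n)) \<longlonglongrightarrow> lk_trunc ?d x y"
    unfolding lk_trunc_def by (intro tendsto_intros assms) (rule less_imp_neq[symmetric])
  then have "liminf (\<lambda>n. ennreal (lk_trunc ?d (X n) (Y n))) = ennreal (lk_trunc ?d x y)"
    by (intro lim_imp_Liminf tendsto_ennrealI) auto
  moreover have "liminf (\<lambda>n. ennreal (lk_trunc ?d (X n) (Y n))) \<le> liminf (\<lambda>n. lk (X n) (Y n))"
    by (intro Liminf_mono always_eventually allI ennreal_lk_trunc_le) simp
  ultimately show "ennreal (lk_trunc ?d x y) \<le> liminf (\<lambda>n. lk (X n) (Y n))" by simp
qed

lemma energy_distr:
  assumes "prob_space \<Omega>" and [measurable]: "Y \<in> borel_measurable \<Omega>"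
  shows "energy (distr \<Omega> borel Y) = (\<integral>\<^sup>+\<omega>. \<integral>\<^sup>+\<omega>'. lk (Y \<omega>) (Y \<omega>') \<partial>\<Omega> \<partial>\<Omega>)"
proof -
  interpret prob_space \<Omega> by fact
  interpret D: prob_space "distr \<Omega> borel Y" by (rule prob_space_distr) measurable
  have "(\<integral>\<^sup>+y. lk x y \<partial>distr \<Omega> borel Y) = (\<integral>\<^sup>+\<omega>'. lk x (Y \<omega>') \<partial>\<Omega>)" for x
    by (subst nn_integral_distr) measurable
  then show ?thesis
    unfolding energy_def by (simp add: nn_integral_distr)
qed

text \<open>Tightness gives a weakly convergent subsequence, and Skorohod's theorem realizes it by
  random variables converging pointwise. Semicontinuity of the kernel then becomes Fatou's lemma,
  and limits of points in nested closed sets stay in them.\<close>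

lemma weak_limit_energy_le:
  fixes \<mu> :: "nat \<Rightarrow> real measure" and K :: "nat \<Rightarrow> real set"
  assumes prob: "\<And>n. prob_space (\<mu> n)" and sets: "\<And>n. sets (\<mu> n) = sets borel"
    and AE01: "\<And>n. AE x in \<mu> n. x \<in> {0..1}"
    and K: "\<And>n. closed (K n)" "\<And>n. K (Suc n) \<subseteq> K n" "\<And>n. AE x in \<mu> n. x \<in> K n"
    and B: "\<And>n. energy (\<mu> n) \<le> B"
  shows "\<exists>\<nu>. prob_space \<nu> \<and> sets \<nu> = sets borel \<and> (AE x in \<nu>. x \<in> (\<Inter>n. K n)) \<and> energy \<nu> \<le> B"
proof -
  have rd: "real_distribution (\<mu> n)" for n
    by (intro real_distribution.intro real_distribution_axioms.intro prob sets)
  \<comment> \<open>Tightness is phrased with half-open intervals, so the left end is moved below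
    0.\<close>
  have "measure (\<mu> n) {-1<..1} = 1" for n
  proof -
    interpret real_distribution "\<mu> n" by (rule rd)
    have "AE x in \<mu> n. x \<in> {-1<..1}" using AE01[of n] by eventually_elim auto
    then show ?thesis by (subst AE_in_set_eq_1[symmetric]) auto
  qed
  then have "tight \<mu>"
    unfolding tight_def using rd by (intro conjI allI impI exI[of _ "-1"] exI[of _ 1]) auto
  then obtain r \<nu> where r: "strict_mono (r :: nat \<Rightarrow> nat)" and \<nu>: "real_distribution \<nu>" "weak_conv_m (\<mu> \<circ> id \<circ> r) \<nu>"
    using tight_imp_convergent_subsubsequence[of \<mu> id] by (auto simp: strict_mono_id)
  have "real_distribution ((\<mu> \<circ> id \<circ> r) n)" for n using rd by simp
  from Skorohod[OF this \<nu>] obtain \<Omega> :: "real measure" and Y Z where sk: "prob_space \<Omega> \<and>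
    (\<forall>n. Y n \<in> borel_measurable \<Omega>) \<and> (\<forall>n. distr \<Omega> borel (Y n) = (\<mu> \<circ> id \<circ> r) n) \<and>
    Z \<in> measurable \<Omega> lborel \<and> distr \<Omega> borel Z = \<nu> \<and> (\<forall>\<omega>\<in>space \<Omega>. (\<lambda>n. Y n \<omega>) \<longlonglongrightarrow> Z \<omega>)"
    by blast
  then have \<Omega>: "prob_space \<Omega>" and Y: "\<And>n. Y n \<in> borel_measurable \<Omega>"
    and Y_distr: "\<And>n. distr \<Omega> borel (Y n) = \<mu> (r n)" and Z: "Z \<in> borel_measurable \<Omega>"
    and Z_distr: "distr \<Omega> borel Z = \<nu>" and lim: "\<And>\<omega>. \<omega> \<in> space \<Omega> \<Longrightarrow> (\<lambda>n. Y n \<omega>) \<longlonglongrightarrow> Z \<omega>"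
    by auto
  note [measurable] = Y Z
  interpret \<Omega>: prob_space \<Omega> by fact
  have decr: "K n \<subseteq> K m" if "m \<le> n" for m n
    using K(2) that by (rule lift_Suc_antimono_le)
  have "AE \<omega> in \<Omega>. \<forall>n. Y n \<omega> \<in> K (r n)"
  proof (subst AE_all_countable, rule allI)
    fix n
    have [measurable]: "K (r n) \<in> sets borel" using K(1) by auto
    have "AE x in distr \<Omega> borel (Y n). x \<in> K (r n)" unfolding Y_distr by (rule K(3))
    then show "AE \<omega> in \<Omega>. Y n \<omega> \<in> K (r n)" by (subst (asm) AE_distr_iff) auto
  qed
  then have "AE \<omega> in \<Omega>. Z \<omega> \<in> (\<Inter>n. K n)"
    using AE_space
  proof eventually_elim
    case (elim \<omega>)
    have "Z \<omega> \<in> K m" for m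
    proof (rule Lim_in_closed_set[OF K(1) _ sequentially_bot lim[OF elim(2)]])
      have "Y n \<omega> \<in> K m" if "n \<ge> m" for n
        using elim(1) decr[of m "r n"] seq_suble[OF r, of n] that by auto
      then show "\<forall>\<^sub>F n in sequentially. Y n \<omega> \<in> K m"
        by (auto simp: eventually_sequentially)
    qed
    then show ?case by blast
  qed
  moreover have "{x \<in> space borel. x \<in> (\<Inter>n. K n)} \<in> sets borel"
  proof -
    have "(\<Inter>n. K n) \<in> sets borel" using K(1) by auto
    then show ?thesis by (simp only: space_borel UNIV_I simp_thms Collect_mem_eq)
  qed
  ultimately have "AE x in \<nu>. x \<in> (\<Inter>n. K n)"
    unfolding Z_distr[symmetric] by (simp only: AE_distr_iff[OF Z])
  moreover have "energy \<nu> \<le> B"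
  proof -
    have "energy \<nu> = (\<integral>\<^sup>+\<omega>. \<integral>\<^sup>+\<omega>'. lk (Z \<omega>) (Z \<omega>') \<partial>\<Omega> \<partial>\<Omega>)"
      unfolding Z_distr[symmetric] by (rule energy_distr) fact+
    also have "\<dots> \<le> (\<integral>\<^sup>+\<omega>. \<integral>\<^sup>+\<omega>'. liminf (\<lambda>n. lk (Y n \<omega>) (Y n \<omega>')) \<partial>\<Omega> \<partial>\<Omega>)"
      by (intro nn_integral_mono lk_le_liminf lim)
    also have "\<dots> \<le> (\<integral>\<^sup>+\<omega>. liminf (\<lambda>n. \<integral>\<^sup>+\<omega>'. lk (Y n \<omega>) (Y n \<omega>') \<partial>\<Omega>) \<partial>\<Omega>)"
      by (intro nn_integral_mono nn_integral_liminf) measurable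
    also have "\<dots> \<le> liminf (\<lambda>n. \<integral>\<^sup>+\<omega>. \<integral>\<^sup>+\<omega>'. lk (Y n \<omega>) (Y n \<omega>') \<partial>\<Omega> \<partial>\<Omega>)"
      by (intro nn_integral_liminf) measurable
    also have "\<dots> = liminf (\<lambda>n. energy (\<mu> (r n)))"
      by (simp add: Y_distr[symmetric] energy_distr[OF \<Omega>])
    also have "\<dots> \<le> liminf (\<lambda>n. B)"
      by (intro Liminf_mono always_eventually allI B)
    finally show ?thesis by (simp add: Liminf_const)
  qed
  moreover have "prob_space \<nu>" "sets \<nu> = sets borel"
    using \<nu>(1) by (auto simp: real_distribution_def real_distribution_axioms_def)
  ultimately show ?thesis by blast
qed

text \<open>After smoothing, dependent choice iterates the refinement. The n-th compact set lies in
  the union of the intervals with index at least n, so the intersection lies in the limsup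
  set.\<close>

lemma (in equidistributed_centers) exists_measure_on_limsup:
  fixes b :: real
  assumes "prob_space \<mu>" "sets \<mu> = sets borel" "AE x in \<mu>. x \<in> {0..1}" "energy \<mu> < ennreal b"
  shows "\<exists>\<nu> K. prob_space \<nu> \<and> sets \<nu> = sets borel \<and> compact K \<and>
    K \<subseteq> limsup_intervals c (\<lambda>k. exp (- lam * real k)) \<and> emeasure \<nu> K = 1 \<and> energy \<nu> \<le> ennreal b"
proof -
  \<comment> \<open>A state is a measure with an open set carrying it. The strict bound with the
    same \<open>b\<close> is part of the invariant.\<close>
  define good where "good = (\<lambda>(\<mu> :: real measure, U). prob_space \<mu> \<and> sets \<mu> = sets borel \<and> absolutely_continuous lborel \<mu> \<and>
    open U \<and> U \<subseteq> {0<..<1} \<and> (AE x in \<mu>. x \<in> U) \<and> energy \<mu> < ennreal b)"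
  define step where "step m = (\<lambda>(\<mu> :: real measure, U) (\<mu>' :: real measure, U'). \<exists>K. compact K \<and> U' \<subseteq> K \<and> K \<subseteq> U \<and>
    K \<subseteq> (\<Union>k\<in>{m..}. {c k - exp (- lam * real k) / 2<..<c k + exp (- lam * real k) / 2}))" for m :: nat
  have "\<exists>S. \<forall>n. good (S n) \<and> step n (S n) (S (Suc n))"
  proof (rule dependent_nat_choice)
    obtain \<mu>0 where "prob_space \<mu>0" "sets \<mu>0 = sets borel" "absolutely_continuous lborel \<mu>0"
           "AE x in \<mu>0. x \<in> {0<..<1}" "energy \<mu>0 < ennreal b"
      using energy_smoothing[OF assms] by blast
    then show "\<exists>x. good x" by (intro exI[of _ "(\<mu>0, {0<..<1})"]) (simp add: good_def)
    fix x n assume x: "good x"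
    obtain \<mu> U where xU: "x = (\<mu>, U)" by (cases x)
    from x obtain \<mu>' U' K where "prob_space \<mu>' \<and> sets \<mu>' = sets borel \<and> absolutely_continuous lborel \<mu>' \<and> open U' \<and>
      (AE x in \<mu>'. x \<in> U') \<and> energy \<mu>' < ennreal b \<and> compact K \<and> U' \<subseteq> K \<and> K \<subseteq> U \<and>
      K \<subseteq> (\<Union>k\<in>{n..}. {c k - exp (- lam * real k) / 2<..<c k + exp (- lam * real k) / 2})"
      using refine_measure[of \<mu> U b n] unfolding good_def xU prod.case by blast
    with x show "\<exists>y. good y \<and> step n x y"
      unfolding good_def step_def xU by (intro exI[of _ "(\<mu>', U')"]) auto
  qed
  then obtain S where S: "\<And>n. good (S n)" "\<And>n. step n (S n) (S (Suc n))" by blast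
  then have "\<forall>n. \<exists>K. compact K \<and> snd (S (Suc n)) \<subseteq> K \<and> K \<subseteq> snd (S n) \<and>
    K \<subseteq> (\<Union>k\<in>{n..}. {c k - exp (- lam * real k) / 2<..<c k + exp (- lam * real k) / 2})"
    unfolding step_def case_prod_beta by blast
  from choice[OF this] obtain K where "\<forall>n. compact (K n) \<and> snd (S (Suc n)) \<subseteq> K n \<and> K n \<subseteq> snd (S n) \<and>
    K n \<subseteq> (\<Union>k\<in>{n..}. {c k - exp (- lam * real k) / 2<..<c k + exp (- lam * real k) / 2})" ..
  then have K: "\<And>n. compact (K n)" "\<And>n. snd (S (Suc n)) \<subseteq> K n" "\<And>n. K n \<subseteq> snd (S n)"
    "\<And>n. K n \<subseteq> (\<Union>k\<in>{n..}. {c k - exp (- lam * real k) / 2<..<c k + exp (- lam * real k) / 2})"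
    by blast+
  note good = S(1)[unfolded good_def case_prod_beta]
  \<comment> \<open>The n-th measure is taken from state \<open>Suc n\<close>, whose open set is
    contained in \<open>K n\<close>.\<close>
  have "\<exists>\<nu>. prob_space \<nu> \<and> sets \<nu> = sets borel \<and> (AE x in \<nu>. x \<in> (\<Inter>n. K n)) \<and> energy \<nu> \<le> ennreal b"
  proof (rule weak_limit_energy_le)
    fix n
    show "prob_space (fst (S (Suc n)))" "sets (fst (S (Suc n))) = sets borel" "energy (fst (S (Suc n))) \<le> ennreal b"
      using good[of "Suc n"] by auto
    have AE: "AE x in fst (S (Suc n)). x \<in> snd (S (Suc n))" and U: "snd (S (Suc n)) \<subseteq> {0<..<1}"
      using good[of "Suc n"] by auto
    show "AE x in fst (S (Suc n)). x \<in> {0..1}"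
      by (rule eventually_mono[OF AE]) (use U in force)
    show "AE x in fst (S (Suc n)). x \<in> K n"
      by (rule eventually_mono[OF AE]) (use K(2) in blast)
    show "closed (K n)" using K(1) by (rule compact_imp_closed)
    show "K (Suc n) \<subseteq> K n" using K(2,3) by blast
  qed
  then obtain \<nu> where \<nu>: "prob_space \<nu>" "sets \<nu> = sets borel" "AE x in \<nu>. x \<in> (\<Inter>n. K n)" "energy \<nu> \<le> ennreal b"
    by blast
  interpret \<nu>: prob_space \<nu> by fact
  have comp: "compact (\<Inter>n. K n)" using K(1) by (intro compact_Inter) auto
  moreover have "(\<Inter>n. K n) \<subseteq> limsup_intervals c (\<lambda>k. exp (- lam * real k))"
    unfolding limsup_intervals_def using K(4) by (intro INT_greatest) (meson INT_lower UNIV_I subset_trans)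
  moreover have "emeasure \<nu> (\<Inter>n. K n) = 1"
    using \<nu>(2,3) compact_imp_closed[OF comp] by (intro \<nu>.emeasure_eq_1_AE) auto
  ultimately show ?thesis using \<nu> by blast
qed

section \<open>Passage between measures on the complex plane and on the line\<close>

lemma measurable_log_kernel [measurable]:
  "log_kernel_pos \<in> borel_measurable (borel \<Otimes>\<^sub>M borel)" "log_kernel_neg \<in> borel_measurable (borel \<Otimes>\<^sub>M borel)"
  unfolding log_kernel_pos_def log_kernel_neg_def by measurable

lemma compact_prob_measuresD:
  assumes "M \<in> compact_prob_measures (complex_of_real ` A)"
  shows "prob_space (distr M borel Re)" "AE z in M. z = complex_of_real (Re z) \<and> Re z \<in> A"
    "\<exists>K\<subseteq>A. compact K \<and> (AE x in distr M borel Re. x \<in> K)"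
proof -
  obtain K where sets[measurable_cong]: "sets M = sets borel" and M: "prob_space M"
    and K: "compact K" "K \<subseteq> complex_of_real ` A" "emeasure M K = 1"
    using assms unfolding compact_prob_measures_def by auto
  interpret prob_space M by fact
  show "prob_space (distr M borel Re)" by (rule prob_space_distr) measurable
  have "prob K = 1" using K(3) by (simp add: emeasure_eq_measure)
  then have AE_K: "AE z in M. z \<in> K" by (rule AE_prob_1)
  then show "AE z in M. z = complex_of_real (Re z) \<and> Re z \<in> A"
    by eventually_elim (use K(2) in auto)
  show "\<exists>K\<subseteq>A. compact K \<and> (AE x in distr M borel Re. x \<in> K)"
  proof (intro exI conjI)
    show "Re ` K \<subseteq> A" using K(2) by auto
    show comp: "compact (Re ` K)" by (intro compact_continuous_image K continuous_intros)
    have "{x \<in> space borel. x \<in> Re ` K} \<in> sets borel"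
      using compact_imp_closed[OF comp] by (simp only: space_borel UNIV_I simp_thms Collect_mem_eq borel_closed)
    then show "AE x in distr M borel Re. x \<in> Re ` K"
      by (subst AE_distr_iff) (auto intro: eventually_mono[OF AE_K])
  qed
qed

text \<open>Distances within [0,1] are at most 1, so the negative part of the kernel integrates to 0
  and no difference of infinities arises.\<close>

lemma log_energy_eq:
  assumes M: "M \<in> compact_prob_measures (complex_of_real ` A)" and A: "A \<subseteq> {0..1}"
  shows "log_energy M = enn2ereal (energy (distr M borel Re))"
proof -
  have sets[measurable_cong]: "sets M = sets borel" and "prob_space M"
    using M by (auto simp: compact_prob_measures_def)
  interpret prob_space M by fact
  note AE_M = compact_prob_measuresD(2)[OF M]
  have iterated: "(\<integral>\<^sup>+p. h p \<partial>(M \<Otimes>\<^sub>M M)) = (\<integral>\<^sup>+z. \<integral>\<^sup>+w. h (z, w) \<partial>M \<partial>M)"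
    if [measurable]: "h \<in> borel_measurable (borel \<Otimes>\<^sub>M borel)" for h :: "complex \<times> complex \<Rightarrow> ennreal"
    by (rule nn_integral_fst[symmetric]) measurable
  have "(\<integral>\<^sup>+z. \<integral>\<^sup>+w. log_kernel_pos (z, w) \<partial>M \<partial>M) = (\<integral>\<^sup>+z. \<integral>\<^sup>+w. lk (Re z) (Re w) \<partial>M \<partial>M)"
  proof (rule nn_integral_cong_AE, use AE_M in eventually_elim)
    case (elim z)
    show ?case
    proof (rule nn_integral_cong_AE, use AE_M in eventually_elim)
      case (elim w)
      then show ?case
        using \<open>z = complex_of_real (Re z) \<and> Re z \<in> A\<close> log_kernel_pos_of_real[of "Re z" "Re w"] by simp
    qed
  qed
  also have "\<dots> = energy (distr M borel Re)"
    by (rule energy_distr[symmetric]) (auto intro: prob_space_axioms)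
  finally have pos: "(\<integral>\<^sup>+p. log_kernel_pos p \<partial>(M \<Otimes>\<^sub>M M)) = energy (distr M borel Re)"
    by (simp add: iterated)
  have "(\<integral>\<^sup>+z. \<integral>\<^sup>+w. log_kernel_neg (z, w) \<partial>M \<partial>M) = (\<integral>\<^sup>+z. \<integral>\<^sup>+w. 0 \<partial>M \<partial>M)"
  proof (rule nn_integral_cong_AE, use AE_M in eventually_elim)
    case (elim z)
    show ?case
    proof (rule nn_integral_cong_AE, use AE_M in eventually_elim)
      case (elim w)
      have z: "z = complex_of_real (Re z)" "Re z \<in> {0..1}" and w: "w = complex_of_real (Re w)" "Re w \<in> {0..1}"
        using elim \<open>z = complex_of_real (Re z) \<and> Re z \<in> A\<close> A by auto
      have "cmod (z - w) = \<bar>Re z - Re w\<bar>"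
        by (subst z(1), subst w(1)) (simp flip: of_real_diff)
      then have "cmod (z - w) \<le> 1" using z w by auto
      then have "z \<noteq> w \<Longrightarrow> ln (cmod (z - w)) \<le> 0" by simp
      then show ?case unfolding log_kernel_neg_def by (auto simp: max_def)
    qed
  qed
  then have neg: "(\<integral>\<^sup>+p. log_kernel_neg p \<partial>(M \<Otimes>\<^sub>M M)) = 0" by (simp add: iterated)
  show ?thesis unfolding log_energy_def pos neg by (simp add: zero_ennreal.rep_eq)
qed

lemma compact_prob_measures_of_real:
  assumes "prob_space \<nu>" and sets[measurable_cong]: "sets \<nu> = sets borel"
    and K: "compact K" "K \<subseteq> A" "emeasure \<nu> K = 1"
  shows "distr \<nu> borel complex_of_real \<in> compact_prob_measures (complex_of_real ` A)"
    "distr (distr \<nu> borel complex_of_real) borel Re = \<nu>"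
proof -
  interpret prob_space \<nu> by fact
  have "compact (complex_of_real ` K)" by (intro compact_continuous_image K continuous_intros)
  moreover have "emeasure (distr \<nu> borel complex_of_real) (complex_of_real ` K) = 1"
  proof -
    have "emeasure (distr \<nu> borel complex_of_real) (complex_of_real ` K) = emeasure \<nu> (complex_of_real -` (complex_of_real ` K) \<inter> space \<nu>)"
      using compact_imp_closed[OF \<open>compact (complex_of_real ` K)\<close>] by (intro emeasure_distr) auto
    also have "complex_of_real -` (complex_of_real ` K) \<inter> space \<nu> = K"
      using sets_eq_imp_space_eq[OF sets] by (auto simp: inj_image_mem_iff)
    finally show ?thesis using K by simp
  qed
  moreover have "prob_space (distr \<nu> borel complex_of_real)" by (rule prob_space_distr) measurable
  ultimately show "distr \<nu> borel complex_of_real \<in> compact_prob_measures (complex_of_real ` A)"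
    using K(2) unfolding compact_prob_measures_def by (auto intro!: exI[of _ "complex_of_real ` K"])
  show "distr (distr \<nu> borel complex_of_real) borel Re = \<nu>"
    by (subst distr_distr) (auto simp: comp_def distr_id2 sets)
qed

lemma limsup_intervals_mono:
  assumes "\<And>k. k \<ge> 1 \<Longrightarrow> l k \<le> l' k"
  shows "limsup_intervals c l \<subseteq> limsup_intervals c l'"
proof
  fix x assume x: "x \<in> limsup_intervals c l"
  show "x \<in> limsup_intervals c l'"
    unfolding limsup_intervals_def
  proof (rule INT_I)
    fix m :: nat assume m: "m \<in> {1..}"
    with x obtain k where k: "k \<ge> m" "x \<in> {c k - l k / 2<..<c k + l k / 2}"
      unfolding limsup_intervals_def by blast
    then have "l k \<le> l' k" using m by (intro assms) auto
    then have "x \<in> {c k - l' k / 2<..<c k + l' k / 2}" using k(2) by auto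
    then show "x \<in> (\<Union>k\<in>{m..}. {c k - l' k / 2<..<c k + l' k / 2})" using k(1) by blast
  qed
qed

text \<open>An interval may stick out of (0,1) by half its length; as lengths tend to 0, limsup
  points stay in the closed interval.\<close>

lemma limsup_intervals_subset_Icc:
  assumes c: "\<And>k. k \<ge> 1 \<Longrightarrow> c k \<in> {0<..<1}" and l: "l \<longlonglongrightarrow> 0"
  shows "limsup_intervals c l \<subseteq> {0..1}"
proof
  fix x assume x: "x \<in> limsup_intervals c l"
  have close: "- r \<le> x \<and> x \<le> 1 + r" if "r > 0" for r
  proof -
    have "\<forall>\<^sub>F k in sequentially. l k < 2 * r" using l by (rule order_tendstoD) (use that in simp)
    then obtain m where m: "\<And>k. k \<ge> m \<Longrightarrow> l k < 2 * r" by (auto simp: eventually_sequentially)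
    have "x \<in> (\<Union>k\<in>{max 1 m..}. {c k - l k / 2<..<c k + l k / 2})"
      using x unfolding limsup_intervals_def by (rule INT_D) simp
    then obtain k where k: "k \<ge> max 1 m" "x \<in> {c k - l k / 2<..<c k + l k / 2}" by blast
    show ?thesis using k(2) m[of k] c[of k] k(1) by auto
  qed
  have "x \<le> 1 + r" "0 \<le> x + r" if "r > 0" for r
    using close[OF that] by linarith+
  then have "x \<le> 1" "0 \<le> x" by (blast intro: field_le_epsilon)+
  then show "x \<in> {0..1}" by simp
qed

lemma tendsto_exp_neg_powr:
  assumes "lam > 0" "alpha > 0"
  shows "(\<lambda>k. exp (- lam * real k powr alpha)) \<longlonglongrightarrow> 0"
proof -
  have "filterlim (\<lambda>k. real k powr alpha) at_top sequentially"
    unfolding filterlim_at_top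
  proof
    fix R :: real
    obtain m :: nat where m: "max 1 R powr (1 / alpha) \<le> real m" using real_arch_simple by blast
    have "R \<le> real k powr alpha" if "k \<ge> m" for k
    proof -
      have "max 1 R = (max 1 R powr (1 / alpha)) powr alpha" using assms by (simp add: powr_powr)
      also have "\<dots> \<le> real k powr alpha" using m that assms by (intro powr_mono2) auto
      finally show ?thesis by simp
    qed
    then show "\<forall>\<^sub>F k in sequentially. R \<le> real k powr alpha" by (auto simp: eventually_sequentially)
  qed
  then have "filterlim (\<lambda>k. lam * real k powr alpha) at_top sequentially"
    by (rule filterlim_tendsto_pos_mult_at_top[OF tendsto_const assms(1)])
  then have "filterlim (\<lambda>k. - lam * real k powr alpha) at_bot sequentially"
    by (simp add: filterlim_uminus_at_bot)
  then show ?thesis by (rule filterlim_compose[OF exp_at_bot])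
qed

lemma log_capacity_pos:
  assumes "M \<in> compact_prob_measures E" "log_energy M < \<infinity>"
  shows "log_capacity E > 0"
proof -
  have "(INF M\<in>compact_prob_measures E. log_energy M) < \<infinity>"
    using assms by (meson INF_lower le_less_trans)
  then show ?thesis by (auto simp: log_capacity_def Let_def)
qed

lemma log_capacity_Icc_pos: "log_capacity (complex_of_real ` {0..1}) > 0"
proof -
  \<comment> \<open>The unsimplified \<open>1 / 1\<close> and \<open>0 + 1\<close> match the lemmas
    on uniform distributions with \<open>l = 1\<close> and \<open>a = 0\<close>; the energy is at
    most \<open>2 - ln 1\<close>.\<close>
  define u where "u y = ennreal (1 / 1) * indicator {0..0 + 1} y" for y :: real
  have [measurable]: "u \<in> borel_measurable borel" unfolding u_def by measurable
  let ?\<nu> = "density lborel u"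
  have "prob_space ?\<nu>"
  proof
    have "(\<integral>\<^sup>+y. u y * 1 \<partial>lborel) = 1" unfolding u_def by (rule nn_integral_uniform_const) simp
    then show "emeasure ?\<nu> (space ?\<nu>) = 1" by (simp add: emeasure_density)
  qed
  then interpret prob_space ?\<nu> .
  have "AE x in ?\<nu>. x \<in> {0..1}"
    by (subst AE_density) (auto simp: u_def indicator_def)
  then have "emeasure ?\<nu> {0..1} = 1" by (intro emeasure_eq_1_AE) auto
  then have M: "distr ?\<nu> borel complex_of_real \<in> compact_prob_measures (complex_of_real ` {0..1})"
    "distr (distr ?\<nu> borel complex_of_real) borel Re = ?\<nu>"
    using compact_prob_measures_of_real[of ?\<nu> "{0..1}" "{0..1}"] prob_space_axioms by auto
  have "energy ?\<nu> = (\<integral>\<^sup>+x. u x * (\<integral>\<^sup>+y. u y * lk x y \<partial>lborel) \<partial>lborel)"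
    unfolding energy_def by (simp add: nn_integral_density)
  also have "\<dots> \<le> ennreal (2 - ln 1)"
    unfolding u_def by (rule mutual_uniform_energy_le_ln) auto
  finally have "energy ?\<nu> < \<infinity>" by (simp add: le_less_trans)
  then have "log_energy (distr ?\<nu> borel complex_of_real) < \<infinity>"
    using log_energy_eq[OF M(1)] M(2) by (cases "energy ?\<nu>") auto
  with M(1) show ?thesis by (rule log_capacity_pos)
qed

text \<open>Fewer measures on \<open>A\<close> give one inequality; for the other, a measure on
  [0,1] of finite energy e is replaced by one on \<open>A\<close> of energy at most e + r, for every
  r > 0. Admitting supersets \<open>A\<close> covers all \<open>alpha \<le> 1\<close> at
  once.\<close>

lemma (in equidistributed_centers) log_capacity_limsup_superset:
  assumes "limsup_intervals c (\<lambda>k. exp (- lam * real k)) \<subseteq> A" "A \<subseteq> {0..1}"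
  shows "log_capacity (complex_of_real ` A) = log_capacity (complex_of_real ` {0..1})"
proof -
  let ?J = "\<lambda>A. INF M\<in>compact_prob_measures (complex_of_real ` A). log_energy M"
  have "?J A = ?J {0..1}"
  proof (rule antisym)
    show "?J {0..1} \<le> ?J A"
      by (rule INF_superset_mono) (use assms(2) in \<open>force simp: compact_prob_measures_def\<close>, simp)
    show "?J A \<le> ?J {0..1}"
    proof (rule INF_greatest)
      fix M assume M: "M \<in> compact_prob_measures (complex_of_real ` {0..1})"
      let ?\<mu> = "distr M borel Re"
      have \<mu>: "prob_space ?\<mu>" "AE x in ?\<mu>. x \<in> {0..1}"
        using compact_prob_measuresD[OF M] by (auto elim!: eventually_mono)
      show "?J A \<le> log_energy M"
      proof (cases "energy ?\<mu>")
        case top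
        then show ?thesis using log_energy_eq[OF M] by simp
      next
        case (real e)
        have "?J A \<le> ereal e + ereal r" if "r > 0" for r
        proof -
          have "energy ?\<mu> < ennreal (e + r)" using real that by (simp add: ennreal_less_iff)
          from exists_measure_on_limsup[OF \<mu>(1) _ \<mu>(2) this]
          obtain \<nu> K where \<nu>: "prob_space \<nu>" "sets \<nu> = sets borel" "compact K" "K \<subseteq> A" "emeasure \<nu> K = 1"
            "energy \<nu> \<le> ennreal (e + r)"
            using assms(1) by (auto dest: subset_trans)
          note M' = compact_prob_measures_of_real[OF \<nu>(1-5)]
          have "?J A \<le> log_energy (distr \<nu> borel complex_of_real)" using M'(1) by (rule INF_lower)
          also have "\<dots> = enn2ereal (energy \<nu>)" using log_energy_eq[OF M'(1) assms(2)] M'(2) by simp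
          also have "\<dots> \<le> enn2ereal (ennreal (e + r))" using \<nu>(6) by (simp add: less_eq_ennreal.rep_eq)
          also have "\<dots> = ereal e + ereal r" using real that by (subst enn2ereal_ennreal) auto
          finally show ?thesis .
        qed
        then have "?J A \<le> ereal e" by (rule ereal_le_epsilon2)
        then show ?thesis using log_energy_eq[OF M] real by simp
      qed
    qed
  qed
  then show ?thesis unfolding log_capacity_def by simp
qed

text \<open>An admissible measure is carried by a compact subset of the limsup set, which a measure
  of finite energy does not charge. So every admissible energy is infinite; an empty infimum is
  infinite too.\<close>

lemma log_capacity_limsup_eq_0:
  assumes subset: "limsup_intervals c l \<subseteq> {0..1}"
    and l: "\<And>k. k \<ge> 1 \<Longrightarrow> 0 < l k \<and> l k < 1" and summable: "summable (\<lambda>k. 1 / (- ln (l k)))"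
  shows "log_capacity (complex_of_real ` limsup_intervals c l) = 0"
proof -
  have "log_energy M = \<infinity>" if M: "M \<in> compact_prob_measures (complex_of_real ` limsup_intervals c l)" for M
  proof -
    let ?\<mu> = "distr M borel Re"
    interpret prob_space ?\<mu> using compact_prob_measuresD(1)[OF M] .
    obtain K where K: "K \<subseteq> limsup_intervals c l" "AE x in ?\<mu>. x \<in> K"
      using compact_prob_measuresD(3)[OF M] by blast
    have "energy ?\<mu> = \<infinity>"
    proof (rule ccontr)
      assume "energy ?\<mu> \<noteq> \<infinity>"
      then have "AE x in ?\<mu>. x \<notin> limsup_intervals c l"
        by (intro limsup_intervals_AE_not_mem l summable prob_space_axioms) (auto simp: less_top)
      with K(2) have "AE x in ?\<mu>. False" by eventually_elim (use K(1) in blast)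
      then show False by simp
    qed
    then show ?thesis using log_energy_eq[OF M subset] by simp
  qed
  then have "(INF M\<in>compact_prob_measures (complex_of_real ` limsup_intervals c l). log_energy M) = \<infinity>"
    by (simp add: top_ereal_def[symmetric] cong: INF_cong)
  then show ?thesis by (simp add: log_capacity_def)
qed

lemma summable_inverse_neg_ln_exp_powr:
  assumes "lam > 0" "alpha > 1"
  shows "summable (\<lambda>k. 1 / (- ln (exp (- lam * real k powr alpha))))"
proof -
  have "summable (\<lambda>k. 1 / lam * real k powr (- alpha))"
    using assms by (intro summable_mult) (simp add: summable_real_powr_iff)
  then show ?thesis by (simp add: powr_minus_divide)
qed

text \<open>The function \<open>\<psi>\<close> repairs \<open>\<phi>\<close>, which is positive only
  almost everywhere and unrestricted outside [0,1], into a density that is nonnegative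
  everywhere.\<close>

lemma equidistributed_centersI:
  fixes lam :: real and c :: "nat \<Rightarrow> real" and q :: "nat \<Rightarrow> nat" and \<phi> :: "real \<Rightarrow> real"
  assumes lam_pos: "lam > 0"
    and c_range: "\<And>k. k \<ge> 1 \<Longrightarrow> c k \<in> {0<..<1}"
    and \<phi>: "set_integrable lborel {0..1} \<phi>" "AE x in lborel. x \<in> {0..1} \<longrightarrow> \<phi> x > 0"
    and A1: "\<And>f :: real \<Rightarrow> real. continuous_on {0..1} f \<Longrightarrow>
                  (\<lambda>n. (1 / real (card (blockA n))) * (\<Sum>k\<in>blockA n. f (c k)))
                    \<longlonglongrightarrow> (LBINT x:{0..1}. f x * \<phi> x)"
    and q_lim: "filterlim q at_top sequentially"
    and A2: "\<And>\<epsilon>. \<epsilon> > 0 \<Longrightarrow> \<exists>\<delta>>0. \<forall>\<^sub>F n in sequentially.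
               \<forall>a b. a \<le> q n \<and> b \<le> q n \<longrightarrow>
                 (1 / real (card (blockA (2^a * n) \<times> blockA (2^b * n)))) *
                 (\<Sum>(i,j)\<in>{(i,j). i \<in> blockA (2^a * n) \<and> j \<in> blockA (2^b * n) \<and>
                                   i \<noteq> j \<and> \<bar>c i - c j\<bar> < \<delta>}.
                     - ln \<bar>c i - c j\<bar>) < \<epsilon>"
    and A3: "\<And>\<epsilon>. \<epsilon> > 0 \<Longrightarrow> \<forall>\<^sub>F n in sequentially.
               \<forall>i\<in>blockAq n (q n). \<forall>j\<in>blockAq n (q n). i \<noteq> j \<longrightarrow>
                 exp (- lam * real i) + exp (- lam * real j) < 2 * \<epsilon> * \<bar>c i - c j\<bar>"
  defines "\<psi> \<equiv> \<lambda>x. max 0 (indicator {0..1} x * \<phi> x)"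
  shows "equidistributed_centers lam c q (density lborel (\<lambda>x. ennreal (\<psi> x)))"
proof -
  let ?P = "density lborel (\<lambda>x. ennreal (\<psi> x))"
  have int: "integrable lborel (\<lambda>x. indicator {0..1} x * \<phi> x)"
    using \<phi>(1) by (simp add: set_integrable_def)
  have [measurable]: "(\<lambda>x. indicator {0..1} x * \<phi> x) \<in> borel_measurable borel"
    using borel_measurable_integrable[OF int] by simp
  have [measurable]: "\<psi> \<in> borel_measurable borel" unfolding \<psi>_def by measurable
  have \<psi>_nn: "0 \<le> \<psi> x" for x by (simp add: \<psi>_def)
  have \<psi>_eq: "AE x in lborel. \<psi> x = indicator {0..1} x * \<phi> x"
    using \<phi>(2) by eventually_elim (auto simp: \<psi>_def indicator_def)
  have LBINT: "(LBINT x:{0..1}. f x * \<phi> x) = (\<integral>x. f x \<partial>?P)" if [measurable]: "f \<in> borel_measurable borel" for f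
  proof -
    have "(LBINT x:{0..1}. f x * \<phi> x) = (\<integral>x. f x * (indicator {0..1} x * \<phi> x) \<partial>lborel)"
      unfolding set_lebesgue_integral_def by (simp add: ac_simps)
    also have "\<dots> = (\<integral>x. \<psi> x * f x \<partial>lborel)"
    proof (rule integral_cong_AE)
      show "AE x in lborel. f x * (indicator {0..1} x * \<phi> x) = \<psi> x * f x"
        using \<psi>_eq by eventually_elim simp
    qed measurable
    also have "\<dots> = (\<integral>x. f x \<partial>?P)" using \<psi>_nn by (simp add: integral_density)
    finally show ?thesis .
  qed
  show ?thesis
  proof (rule equidistributed_centers.intro)
    show "lam > 0" "filterlim q at_top sequentially" by fact+
    show "c k \<in> {0<..<1}" if "k \<ge> 1" for k using that by (rule c_range)
    show "sets ?P = sets borel" by simp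
    show average: "(\<lambda>n. (\<Sum>k\<in>blockA n. f (c k)) / real n) \<longlonglongrightarrow> (\<integral>x. f x \<partial>?P)"
      if "continuous_on {0..1} f" "f \<in> borel_measurable borel" for f
      using A1[OF that(1)] LBINT[OF that(2)] by simp
    \<comment> \<open>That the density has total mass 1 is not assumed; it follows from (A1) with
      the constant test function 1.\<close>
    have "(\<lambda>n. (\<Sum>k\<in>blockA n. 1) / real n) \<longlonglongrightarrow> (1::real)"
      by (rule tendsto_eventually) (auto intro: eventually_mono[OF eventually_ge_at_top[of 1]])
    moreover have "(\<lambda>n. (\<Sum>k\<in>blockA n. 1) / real n) \<longlonglongrightarrow> (\<integral>x. 1 \<partial>?P)"
      by (rule average) auto
    ultimately have "(\<integral>x. 1 \<partial>?P) = (1::real)" by (rule LIMSEQ_unique[symmetric])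
    then have one: "(\<integral>x. \<psi> x \<partial>lborel) = 1" using \<psi>_nn by (subst (asm) integral_density) auto
    have "integrable lborel \<psi>"
      using int unfolding \<psi>_def by (intro Bochner_Integration.integrable_max) auto
    then show "prob_space ?P"
      using one \<psi>_nn by (intro prob_spaceI) (simp add: emeasure_density nn_integral_eq_integral)
    have "(\<lambda>x. ennreal (\<psi> x)) \<in> borel_measurable lborel" by measurable
    from AE_density[OF this] show "AE x in ?P. x \<in> {0..1}"
      by (rule iffD2) (auto simp: \<psi>_def indicator_def)
    show "absolutely_continuous lborel ?P" by (rule absolutely_continuousI_density) measurable
    show "N \<inter> {0<..<1} \<in> null_sets lborel" if "N \<in> null_sets ?P" for N
    proof -
      have N: "N \<in> sets lborel" "AE x in lborel. x \<in> N \<longrightarrow> ennreal (\<psi> x) = 0"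
        using that by (auto simp: null_sets_density_iff)
      have "AE x in lborel. x \<notin> N \<inter> {0<..<1}"
        using N(2) \<phi>(2) by eventually_elim (auto simp: \<psi>_def)
      then show ?thesis using N(1) by (subst AE_iff_null_sets) auto
    qed
    show "\<forall>\<^sub>F n in sequentially. \<forall>i\<in>blockAq n (q n). \<forall>j\<in>blockAq n (q n). i \<noteq> j \<longrightarrow>
                 exp (- lam * real i) + exp (- lam * real j) < 2 * \<epsilon> * \<bar>c i - c j\<bar>" if "\<epsilon> > 0" for \<epsilon>
      using that by (rule A3)
    show "\<exists>\<delta>>0. \<forall>\<^sub>F n in sequentially. \<forall>a b. a \<le> q n \<and> b \<le> q n \<longrightarrow>
          (\<Sum>i\<in>blockA (2^a * n). \<Sum>j\<in>blockA (2^b * n).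
             if i \<noteq> j \<and> \<bar>c i - c j\<bar> < \<delta> then - ln \<bar>c i - c j\<bar> else 0)
          < \<epsilon> * (real (2^a * n) * real (2^b * n))" if \<epsilon>: "\<epsilon> > 0" for \<epsilon>
    proof -
      from A2[OF \<epsilon>] obtain \<delta> where "\<delta> > 0" and \<delta>: "\<forall>\<^sub>F n in sequentially.
               \<forall>a b. a \<le> q n \<and> b \<le> q n \<longrightarrow>
                 (1 / real (card (blockA (2^a * n) \<times> blockA (2^b * n)))) *
                 (\<Sum>(i,j)\<in>{(i,j). i \<in> blockA (2^a * n) \<and> j \<in> blockA (2^b * n) \<and>
                                   i \<noteq> j \<and> \<bar>c i - c j\<bar> < \<delta>}.
                     - ln \<bar>c i - c j\<bar>) < \<epsilon>" by blast
      from \<delta> eventually_ge_at_top[of 1] have "\<forall>\<^sub>F n in sequentially. \<forall>a b. a \<le> q n \<and> b \<le> q n \<longrightarrow>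
          (\<Sum>i\<in>blockA (2^a * n). \<Sum>j\<in>blockA (2^b * n).
             if i \<noteq> j \<and> \<bar>c i - c j\<bar> < \<delta> then - ln \<bar>c i - c j\<bar> else 0)
          < \<epsilon> * (real (2^a * n) * real (2^b * n))"
      proof (eventually_elim, intro allI impI)
        fix n a b
        assume *: "\<forall>a b. a \<le> q n \<and> b \<le> q n \<longrightarrow>
                 (1 / real (card (blockA (2^a * n) \<times> blockA (2^b * n)))) *
                 (\<Sum>(i,j)\<in>{(i,j). i \<in> blockA (2^a * n) \<and> j \<in> blockA (2^b * n) \<and>
                                   i \<noteq> j \<and> \<bar>c i - c j\<bar> < \<delta>}.
                     - ln \<bar>c i - c j\<bar>) < \<epsilon>"
          and n: "1 \<le> n" and ab: "a \<le> q n \<and> b \<le> q n"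
        let ?N = "real (2^a * n) * real (2^b * n)"
        have N: "?N > 0" using n by (simp add: Suc_le_eq)
        have "(1 / real (card (blockA (2^a * n) \<times> blockA (2^b * n)))) *
                 (\<Sum>i\<in>blockA (2^a * n). \<Sum>j\<in>blockA (2^b * n).
             if i \<noteq> j \<and> \<bar>c i - c j\<bar> < \<delta> then - ln \<bar>c i - c j\<bar> else 0) < \<epsilon>"
          using *[rule_format, OF ab] by (subst (asm) sum_pairs_Collect) auto
        also have "real (card (blockA (2^a * n) \<times> blockA (2^b * n))) = ?N"
          unfolding card_cartesian_product card_blockA by (rule of_nat_mult)
        finally show "(\<Sum>i\<in>blockA (2^a * n). \<Sum>j\<in>blockA (2^b * n).
             if i \<noteq> j \<and> \<bar>c i - c j\<bar> < \<delta> then - ln \<bar>c i - c j\<bar> else 0) < \<epsilon> * ?N"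
          using pos_divide_less_eq[OF N] by (simp only: times_divide_eq_left mult_1)
      qed
      with \<open>\<delta> > 0\<close> show ?thesis by blast
    qed
  qed
qed

theorem theorem1p8:
  fixes lam alpha :: real and c :: "nat \<Rightarrow> real" and q :: "nat \<Rightarrow> nat"
  assumes lam_pos: "lam > 0"
    and c_range: "\<And>k. k \<ge> 1 \<Longrightarrow> c k \<in> {0<..<1}"
    and A1: "\<exists>\<phi> :: real \<Rightarrow> real.
               set_integrable lborel {0..1} \<phi> \<and>
               (AE x in lborel. x \<in> {0..1} \<longrightarrow> \<phi> x > 0) \<and>
               (\<forall>f :: real \<Rightarrow> real. continuous_on {0..1} f \<longrightarrow>
                  (\<lambda>n. (1 / real (card (blockA n))) * (\<Sum>k\<in>blockA n. f (c k)))
                    \<longlonglongrightarrow> (LBINT x:{0..1}. f x * \<phi> x))"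
    and q_lim: "filterlim q at_top sequentially"
    and A2: "\<And>\<epsilon>. \<epsilon> > 0 \<Longrightarrow> \<exists>\<delta>>0. \<forall>\<^sub>F n in sequentially.
               \<forall>a b. a \<le> q n \<and> b \<le> q n \<longrightarrow>
                 (1 / real (card (blockA (2^a * n) \<times> blockA (2^b * n)))) *
                 (\<Sum>(i,j)\<in>{(i,j). i \<in> blockA (2^a * n) \<and> j \<in> blockA (2^b * n) \<and>
                                   i \<noteq> j \<and> \<bar>c i - c j\<bar> < \<delta>}.
                     - ln \<bar>c i - c j\<bar>) < \<epsilon>"
    and A3: "\<And>\<epsilon>. \<epsilon> > 0 \<Longrightarrow> \<forall>\<^sub>F n in sequentially.
               \<forall>i\<in>blockAq n (q n). \<forall>j\<in>blockAq n (q n). i \<noteq> j \<longrightarrow>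
                 exp (- lam * real i) + exp (- lam * real j) < 2 * \<epsilon> * \<bar>c i - c j\<bar>"
    and alpha_pos: "alpha > 0"
  shows "(alpha \<le> 1 \<longrightarrow>
            log_capacity (complex_of_real ` limsup_intervals c (\<lambda>k. exp (- lam * real k powr alpha)))
              = log_capacity (complex_of_real ` {0..1})
            \<and> log_capacity (complex_of_real ` {0..1}) > 0)
       \<and> (alpha > 1 \<longrightarrow>
            log_capacity (complex_of_real ` limsup_intervals c (\<lambda>k. exp (- lam * real k powr alpha))) = 0)"
proof (intro conjI impI log_capacity_Icc_pos)
  have subset: "limsup_intervals c (\<lambda>k. exp (- lam * real k powr alpha)) \<subseteq> {0..1}"
    by (rule limsup_intervals_subset_Icc[OF c_range tendsto_exp_neg_powr[OF lam_pos alpha_pos]])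
  show "log_capacity (complex_of_real ` limsup_intervals c (\<lambda>k. exp (- lam * real k powr alpha)))
      = log_capacity (complex_of_real ` {0..1})" if "alpha \<le> 1"
  proof -
    from A1 obtain \<phi> :: "real \<Rightarrow> real" where \<phi>: "set_integrable lborel {0..1} \<phi>" "AE x in lborel. x \<in> {0..1} \<longrightarrow> \<phi> x > 0"
      and lim: "\<And>f :: real \<Rightarrow> real. continuous_on {0..1} f \<Longrightarrow>
                  (\<lambda>n. (1 / real (card (blockA n))) * (\<Sum>k\<in>blockA n. f (c k)))
                    \<longlonglongrightarrow> (LBINT x:{0..1}. f x * \<phi> x)"
      by blast
    interpret equidistributed_centers lam c q "density lborel (\<lambda>x. ennreal (max 0 (indicator {0..1} x * \<phi> x)))"
      by (rule equidistributed_centersI[OF lam_pos c_range \<phi> lim q_lim A2 A3])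
    show ?thesis
    proof (rule log_capacity_limsup_superset[OF _ subset], rule limsup_intervals_mono)
      fix k :: nat assume "k \<ge> 1"
      then have "real k powr alpha \<le> real k powr 1" using \<open>alpha \<le> 1\<close> by (intro powr_mono) auto
      then show "exp (- lam * real k) \<le> exp (- lam * real k powr alpha)"
        using lam_pos \<open>k \<ge> 1\<close> by simp
    qed
  qed
  show "log_capacity (complex_of_real ` limsup_intervals c (\<lambda>k. exp (- lam * real k powr alpha))) = 0" if "alpha > 1"
    by (rule log_capacity_limsup_eq_0[OF subset])
       (use lam_pos that in \<open>auto intro: summable_inverse_neg_ln_exp_powr[simplified]\<close>)
qed

end
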